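(* Let $X$ be a proper geodesic metric space satisfying Assumptions 0, 1 and 2 and let $\kappa$ be a sublinear function. Then for every $\kappa$-Morse quasi-geodesic ray $\alpha$, the class $[\alpha]_s$ of quasi-geodesic rays that sublinearly fellow travel $\alpha$ equals the quasi-redirecting class $[\alpha]\in P(X)$. Hence $\partial_\kappa X\subset\partial X$ as sets, and moreover $\partial_\kappa X$ is a topological subspace of $\partial X$ (the topology of $\partial_\kappa X$ is the one induced from $\partial X$).
   Context: Let $(X,d)$ be a proper geodesic metric space with a fixed base point $\mathfrak{o}$, and write $\|x\|=d(\mathfrak{o},x)$. Pairs of constants are written $\mathsf{q}=(q,Q)\in[1,\infty)\times[0,\infty)$; maxima and inequalities of pairs are componentwise. A $\mathsf{q}$-quasi-geodesic is a map $\alpha\colon I\to X$, $I\subset\mathbb{R}$ an interval, with $\frac{|t-s|}{q}-Q\le d(\alpha(s),\alpha(t))\le q|t-s|$ for all $s,t\in I$ (in particular $\alpha$ is Lipschitz and continuous). A $\mathsf{q}$-ray is a $\mathsf{q}$-quasi-geodesic $\alpha\colon[0,\infty)\to X$ with $\alpha(0)=\mathfrak{o}$; a quasi-geodesic ray is a $\mathsf{q}$-ray for some $\mathsf{q}$. For $r>0$, $t_r$ denotes the first time with $\|\alpha(t_r)\|\ge r$, $\alpha_r=\alpha(t_r)$, and $\alpha|_r$ is the restriction of $\alpha$ to $[0,t_r]$. A ray $\gamma$ eventually coincides with $\beta$ if there are $t_\gamma>0$ and $t_\beta\in\mathbb{R}$ with $\gamma(t)=\beta(t+t_\beta)$ for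 all $t\ge t_\gamma$. The ray $\alpha$ can be $\mathsf{q}$-redirected to $\beta$ at radius $r$ if there is a $\mathsf{q}$-ray $\gamma$ with $\gamma|_r=\alpha|_r$ that eventually coincides with $\beta$; "can be $\mathsf q$-redirected to $\beta$" (no radius) means at every radius $r>0$. Write $\alpha\preceq\beta$ if there is $\mathsf{q}$ such that $\alpha$ can be $\mathsf{q}$-redirected to $\beta$ at every radius. $\alpha\simeq\beta$ means $\alpha\preceq\beta$ and $\beta\preceq\alpha$. $P(X)$ is the set of equivalence classes $[\alpha]$, partially ordered by $[\alpha]\preceq[\beta]$ iff $\alpha\preceq\beta$. Assumption 0: $X$ is a proper geodesic metric space and there is $\mathsf{q}_0$ such that every point of $X$ lies on a $\mathsf{q}_0$-ray. Assumption 1: there is $\mathsf{q}_0$ such that every class $\mathbf{a}\in P(X)$ contains a $\mathsf{q}_0$-ray; one such ray $\alpha_0\in\mathbf{a}$ is fixed and called the central element of $\mathbf{a}$. Assumption 2: for every $\mathbf{a}\in P(X)$ there is a (fixed) function $f_{\mathbf{a}}\colon[1,\infty)\times[0,\infty)\to[1,\infty)\times[0,\infty)$ such that if $\mathbf{b}\preceq\mathbf{a}$ then every $\mathsf{q}$-ray $\beta\in\mathbf{b}$ can be $f_{\mathbf{a}}(\mathsf{q})$-redirected to $\alpha_0$. Topology of $\partial X$: set $F_{\mathbf{a}}(\mathsf{q})=\max\{f_{\mathbf{a}}(\mathsf{q})+(1,1),(1,q+Q)\}$. A point $x\in X$ is identified with the set of quasi-geodesic rays passing through $x$. For $\mathbf{a}\in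 P(X)$, $r>0$, $\mathcal{U}(\mathbf{a},r)$ is the set of $\mathfrak{b}\in P(X)\cup X$ such that, for every $\mathsf{q}$, every $\mathsf{q}$-ray in $\mathfrak{b}$ can be $F_{\mathbf{a}}(\mathsf{q})$-redirected to $\alpha_0$ at radius $r$. The space $X\cup\partial X$ is $X\cup P(X)$ with the topology in which neighborhoods of $\mathbf{a}\in P(X)$ are the sets containing some $\mathcal{U}(\mathbf{a},r)$ and neighborhoods of $x\in X$ are the sets containing some metric ball $B(x,r)$, $r>0$; $\partial X$ is $P(X)$ with the subspace topology. Sublinear Morse boundary: a sublinear function is a concave continuous $\kappa\colon[0,\infty)\to[1,\infty)$ with $\kappa(t)/t\to0$; write $\kappa(x)=\kappa(\|x\|)$. For a quasi-geodesic ray $\alpha$ (identified with its image), $\mathcal{N}_\kappa(\alpha,m)=\{x: d(x,\alpha)\le m\,\kappa(x)\}$. The ray $\alpha$ is $\kappa$-Morse if there is a proper function $m_\alpha\colon\mathbb{R}^2\to\mathbb{R}$ such that every $\mathsf{q}$-quasi-geodesic segment with endpoints on $\alpha$ lies in $\mathcal{N}_\kappa(\alpha,m_\alpha(\mathsf{q}))$. Equivalently (known) there is a proper $m_\alpha$ such that for every sublinear $\kappa'$ and every $r>0$ there is $R$ such that for every $\mathsf{q}$-ray $\beta$ with $m_\alpha(\mathsf{q})\le\frac{r}{2\kappa(r)}$, $d(\beta_R,\alpha)\le\kappa'(R)$ implies $\beta|_r\subset\mathcal{N}_\kappa(\alpha,m_\alpha(\mathsf{q}))$. A Morse gauge $m_\alpha$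 is chosen so that both properties hold. Write $\alpha\sim_s\beta$ if $\lim_{r\to\infty}d(\alpha_r,\beta_r)/r=0$ (sublinear fellow traveling), and $[\alpha]_s$ for the $\sim_s$-class. $\partial_\kappa X$ is the set of classes $[\alpha]_s$ with $\alpha$ $\kappa$-Morse (each such class contains a geodesic ray, which is $\kappa$-Morse). For $\mathbf{a}\in\partial_\kappa X$ with chosen geodesic representative (central element) $\alpha_0$ and Morse gauge $m_{\alpha_0}$, let $\mathcal{U}_\kappa(\mathbf{a},r)\cap\partial_\kappa X$ be the set of $\mathbf{b}\in\partial_\kappa X$ such that every $\mathsf{q}$-ray $\beta\in\mathbf{b}$ with $m_{\alpha_0}(\mathsf{q})\le\frac{r}{2\kappa(r)}$ satisfies $\beta|_r\subset\mathcal{N}_\kappa(\alpha_0,m_{\alpha_0}(\mathsf{q}))$. The topology of $\partial_\kappa X$ is the one in which the neighborhoods of $\mathbf{a}$ are the sets containing some $\mathcal{U}_\kappa(\mathbf{a},r)\cap\partial_\kappa X$, $r>0$. *)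

theory Defs
  imports "HOL-Analysis.Analysis"
begin

text \<open>A metric space is a type of class \<^class>\<open>metric_space\<close>; \<open>\<oo>\<close> is the base point.
  Paths are total functions \<open>real \<Rightarrow> 'a\<close> of which only the values on the relevant interval matter:
  every notion below looks at a ray on \<open>{0..}\<close> only, so each set of rays considered here is closed
  under changing a ray at negative times.\<close>

definition proper_geodesic_space :: "'a::metric_space itself \<Rightarrow> bool" where
  "proper_geodesic_space _ \<longleftrightarrow>
     (\<forall>(x::'a) r. compact (cball x r)) \<and>
     (\<forall>x y::'a. \<exists>g::real \<Rightarrow> 'a. g 0 = x \<and> g (dist x y) = y \<and>
        (\<forall>s\<in>{0..dist x y}. \<forall>t\<in>{0..dist x y}. dist (g s) (g t) = \<bar>s - t\<bar>))"


subsection \<open>Quasi-geodesics\<close>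

definition admissible :: "real \<times> real \<Rightarrow> bool" where
  "admissible q \<longleftrightarrow> 1 \<le> fst q \<and> 0 \<le> snd q"

definition quasi_geodesic_on :: "real \<times> real \<Rightarrow> real set \<Rightarrow> (real \<Rightarrow> 'a::metric_space) \<Rightarrow> bool" where
  "quasi_geodesic_on q I \<alpha> \<longleftrightarrow> admissible q \<and>
     (\<forall>s\<in>I. \<forall>t\<in>I. \<bar>t - s\<bar> / fst q - snd q \<le> dist (\<alpha> s) (\<alpha> t) \<and>
                    dist (\<alpha> s) (\<alpha> t) \<le> fst q * \<bar>t - s\<bar>)"

definition q_ray :: "'a::metric_space \<Rightarrow> real \<times> real \<Rightarrow> (real \<Rightarrow> 'a) \<Rightarrow> bool" where
  "q_ray \<oo> q \<alpha> \<longleftrightarrow> quasi_geodesic_on q {0..} \<alpha> \<and> \<alpha> 0 = \<oo>"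

definition qg_rays :: "'a::metric_space \<Rightarrow> (real \<Rightarrow> 'a) set" where
  "qg_rays \<oo> = {\<alpha>. \<exists>q. q_ray \<oo> q \<alpha>}"

text \<open>The minimum exists for quasi-geodesic rays and \<open>r > 0\<close>, since these are continuous and
  unbounded.\<close>

definition first_time :: "'a::metric_space \<Rightarrow> (real \<Rightarrow> 'a) \<Rightarrow> real \<Rightarrow> real" where
  "first_time \<oo> \<alpha> r = (LEAST t. 0 \<le> t \<and> r \<le> dist \<oo> (\<alpha> t))"

definition point_at :: "'a::metric_space \<Rightarrow> (real \<Rightarrow> 'a) \<Rightarrow> real \<Rightarrow> 'a" where
  "point_at \<oo> \<alpha> r = \<alpha> (first_time \<oo> \<alpha> r)"

definition initial_part :: "'a::metric_space \<Rightarrow> (real \<Rightarrow> 'a) \<Rightarrow> real \<Rightarrow> 'a set" where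
  "initial_part \<oo> \<alpha> r = \<alpha> ` {0..first_time \<oo> \<alpha> r}"

definition agree_up_to :: "'a::metric_space \<Rightarrow> (real \<Rightarrow> 'a) \<Rightarrow> (real \<Rightarrow> 'a) \<Rightarrow> real \<Rightarrow> bool" where
  "agree_up_to \<oo> \<gamma> \<alpha> r \<longleftrightarrow> first_time \<oo> \<gamma> r = first_time \<oo> \<alpha> r \<and>
     (\<forall>t\<in>{0..first_time \<oo> \<alpha> r}. \<gamma> t = \<alpha> t)"


subsection \<open>Quasi-redirecting\<close>

text \<open>The condition \<open>0 \<le> t + t\<^sub>\<beta>\<close> says that \<open>\<beta>\<close> is only evaluated in its domain.\<close>

definition eventually_coincides :: "(real \<Rightarrow> 'a) \<Rightarrow> (real \<Rightarrow> 'a) \<Rightarrow> bool" where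
  "eventually_coincides \<gamma> \<beta> \<longleftrightarrow>
     (\<exists>t\<^sub>\<gamma>>0. \<exists>t\<^sub>\<beta>. \<forall>t\<ge>t\<^sub>\<gamma>. 0 \<le> t + t\<^sub>\<beta> \<and> \<gamma> t = \<beta> (t + t\<^sub>\<beta>))"

definition redirectable_at ::
    "'a::metric_space \<Rightarrow> real \<times> real \<Rightarrow> (real \<Rightarrow> 'a) \<Rightarrow> (real \<Rightarrow> 'a) \<Rightarrow> real \<Rightarrow> bool" where
  "redirectable_at \<oo> q \<alpha> \<beta> r \<longleftrightarrow>
     (\<exists>\<gamma>. q_ray \<oo> q \<gamma> \<and> agree_up_to \<oo> \<gamma> \<alpha> r \<and> eventually_coincides \<gamma> \<beta>)"

definition redirectable ::
    "'a::metric_space \<Rightarrow> real \<times> real \<Rightarrow> (real \<Rightarrow> 'a) \<Rightarrow> (real \<Rightarrow> 'a) \<Rightarrow> bool" where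
  "redirectable \<oo> q \<alpha> \<beta> \<longleftrightarrow> (\<forall>r>0. redirectable_at \<oo> q \<alpha> \<beta> r)"

definition qr_le :: "'a::metric_space \<Rightarrow> (real \<Rightarrow> 'a) \<Rightarrow> (real \<Rightarrow> 'a) \<Rightarrow> bool" where
  "qr_le \<oo> \<alpha> \<beta> \<longleftrightarrow> (\<exists>q. redirectable \<oo> q \<alpha> \<beta>)"

definition qr_rel :: "'a::metric_space \<Rightarrow> ((real \<Rightarrow> 'a) \<times> (real \<Rightarrow> 'a)) set" where
  "qr_rel \<oo> = {(\<alpha>, \<beta>). \<alpha> \<in> qg_rays \<oo> \<and> \<beta> \<in> qg_rays \<oo> \<and> qr_le \<oo> \<alpha> \<beta> \<and> qr_le \<oo> \<beta> \<alpha>}"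

definition qr_class :: "'a::metric_space \<Rightarrow> (real \<Rightarrow> 'a) \<Rightarrow> (real \<Rightarrow> 'a) set" where
  "qr_class \<oo> \<alpha> = qr_rel \<oo> `` {\<alpha>}"

definition qr_classes :: "'a::metric_space \<Rightarrow> (real \<Rightarrow> 'a) set set" where
  "qr_classes \<oo> = qg_rays \<oo> // qr_rel \<oo>"

definition qr_class_le :: "'a::metric_space \<Rightarrow> (real \<Rightarrow> 'a) set \<Rightarrow> (real \<Rightarrow> 'a) set \<Rightarrow> bool" where
  "qr_class_le \<oo> b a \<longleftrightarrow> (\<exists>\<beta>\<in>b. \<exists>\<alpha>\<in>a. qr_le \<oo> \<beta> \<alpha>)"


subsection \<open>Standing assumptions\<close>

definition assumption0 :: "'a::metric_space \<Rightarrow> bool" where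
  "assumption0 \<oo> \<longleftrightarrow> proper_geodesic_space TYPE('a) \<and>
     (\<exists>q\<^sub>0. \<forall>x. \<exists>\<alpha>. q_ray \<oo> q\<^sub>0 \<alpha> \<and> x \<in> \<alpha> ` {0..})"

text \<open>\<open>c a\<close> is the central element of the class \<open>a\<close>.\<close>

definition assumption1 ::
    "'a::metric_space \<Rightarrow> ((real \<Rightarrow> 'a) set \<Rightarrow> real \<Rightarrow> 'a) \<Rightarrow> bool" where
  "assumption1 \<oo> c \<longleftrightarrow> (\<exists>q\<^sub>0. admissible q\<^sub>0 \<and> (\<forall>a\<in>qr_classes \<oo>. c a \<in> a \<and> q_ray \<oo> q\<^sub>0 (c a)))"

definition assumption2 ::
    "'a::metric_space \<Rightarrow> ((real \<Rightarrow> 'a) set \<Rightarrow> real \<Rightarrow> 'a) \<Rightarrow>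
     ((real \<Rightarrow> 'a) set \<Rightarrow> real \<times> real \<Rightarrow> real \<times> real) \<Rightarrow> bool" where
  "assumption2 \<oo> c f \<longleftrightarrow>
     (\<forall>a\<in>qr_classes \<oo>.
        (\<forall>q. admissible q \<longrightarrow> admissible (f a q)) \<and>
        (\<forall>b\<in>qr_classes \<oo>. qr_class_le \<oo> b a \<longrightarrow>
           (\<forall>q. \<forall>\<beta>\<in>b. q_ray \<oo> q \<beta> \<longrightarrow> redirectable \<oo> (f a q) \<beta> (c a))))"


subsection \<open>Topologies prescribed by neighbourhoods\<close>

text \<open>\<open>N p r\<close> (\<open>r > 0\<close>) are the basic neighbourhoods of \<open>p\<close>; \<open>has_nbhds T S N\<close> says that \<open>T\<close> is
  the topology on \<open>S\<close> in which the neighbourhoods of \<open>p\<close> are exactly the sets containing some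
  \<open>N p r\<close>. There is at most one such topology.\<close>

definition is_nbhd :: "('p \<Rightarrow> real \<Rightarrow> 'p set) \<Rightarrow> 'p \<Rightarrow> 'p set \<Rightarrow> bool" where
  "is_nbhd N p A \<longleftrightarrow> (\<exists>r>0. N p r \<subseteq> A)"

definition has_nbhds :: "'p topology \<Rightarrow> 'p set \<Rightarrow> ('p \<Rightarrow> real \<Rightarrow> 'p set) \<Rightarrow> bool" where
  "has_nbhds T S N \<longleftrightarrow> topspace T = S \<and>
     (\<forall>p\<in>S. \<forall>A. A \<subseteq> S \<longrightarrow> ((\<exists>U. openin T U \<and> p \<in> U \<and> U \<subseteq> A) \<longleftrightarrow> is_nbhd N p A))"

lemma has_nbhds_unique:
  assumes "has_nbhds T S N" "has_nbhds T' S N"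
  shows "T = T'"
proof -
  have *: "openin T\<^sub>1 A \<longleftrightarrow> A \<subseteq> S \<and> (\<forall>p\<in>A. is_nbhd N p A)" if "has_nbhds T\<^sub>1 S N" for T\<^sub>1 A
  proof -
    have "topspace T\<^sub>1 = S" using that by (simp add: has_nbhds_def)
    moreover have "(\<exists>U. openin T\<^sub>1 U \<and> p \<in> U \<and> U \<subseteq> A) \<longleftrightarrow> is_nbhd N p A" if "A \<subseteq> S" "p \<in> A" for p
      using \<open>has_nbhds T\<^sub>1 S N\<close> that unfolding has_nbhds_def by blast
    ultimately show ?thesis
      by (metis openin_subopen openin_subset)
  qed
  show ?thesis
    unfolding topology_eq using assms by (simp add: *)
qed


subsection \<open>The quasi-redirecting boundary\<close>

text \<open>\<open>X \<union> P(X)\<close> is realized as a disjoint sum: distinct points of \<open>X\<close> may lie on the same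
  quasi-geodesic rays, so points cannot literally be replaced by sets of rays.\<close>

definition bordification :: "'a::metric_space \<Rightarrow> ('a + (real \<Rightarrow> 'a) set) set" where
  "bordification \<oo> = UNIV <+> qr_classes \<oo>"

fun rays_of :: "'a::metric_space \<Rightarrow> 'a + (real \<Rightarrow> 'a) set \<Rightarrow> (real \<Rightarrow> 'a) set" where
  "rays_of \<oo> (Inl x) = {\<beta> \<in> qg_rays \<oo>. x \<in> \<beta> ` {0..}}"
| "rays_of \<oo> (Inr b) = b"

definition enlarge ::
    "('c \<Rightarrow> real \<times> real \<Rightarrow> real \<times> real) \<Rightarrow> 'c \<Rightarrow> real \<times> real \<Rightarrow> real \<times> real" where
  "enlarge f a q =
     (max (fst (f a q) + 1) 1, max (snd (f a q) + 1) (fst q + snd q))"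

definition redirect_nbhd ::
    "'a::metric_space \<Rightarrow> ((real \<Rightarrow> 'a) set \<Rightarrow> real \<Rightarrow> 'a) \<Rightarrow>
     ((real \<Rightarrow> 'a) set \<Rightarrow> real \<times> real \<Rightarrow> real \<times> real) \<Rightarrow>
     (real \<Rightarrow> 'a) set \<Rightarrow> real \<Rightarrow> ('a + (real \<Rightarrow> 'a) set) set" where
  "redirect_nbhd \<oo> c f a r =
     {\<bb> \<in> bordification \<oo>. \<forall>q. \<forall>\<beta>\<in>rays_of \<oo> \<bb>. q_ray \<oo> q \<beta> \<longrightarrow>
        redirectable_at \<oo> (enlarge f a q) \<beta> (c a) r}"

fun bordification_nbhd ::
    "'a::metric_space \<Rightarrow> ((real \<Rightarrow> 'a) set \<Rightarrow> real \<Rightarrow> 'a) \<Rightarrow>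
     ((real \<Rightarrow> 'a) set \<Rightarrow> real \<times> real \<Rightarrow> real \<times> real) \<Rightarrow>
     'a + (real \<Rightarrow> 'a) set \<Rightarrow> real \<Rightarrow> ('a + (real \<Rightarrow> 'a) set) set" where
  "bordification_nbhd \<oo> c f (Inl x) r = Inl ` ball x r"
| "bordification_nbhd \<oo> c f (Inr a) r = redirect_nbhd \<oo> c f a r"

text \<open>The subspace topology on \<open>P(X)\<close> of a topology \<open>T\<close> on \<open>X \<union> P(X)\<close>, moved along \<^const>\<open>Inr\<close>.\<close>

definition boundary_topology ::
    "'a::metric_space \<Rightarrow> ('a + (real \<Rightarrow> 'a) set) topology \<Rightarrow> (real \<Rightarrow> 'a) set topology" where
  "boundary_topology \<oo> T = pullback_topology (qr_classes \<oo>) Inr T"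


subsection \<open>The sublinearly Morse boundary\<close>

definition sublinear :: "(real \<Rightarrow> real) \<Rightarrow> bool" where
  "sublinear \<kappa> \<longleftrightarrow> concave_on {0..} \<kappa> \<and> continuous_on {0..} \<kappa> \<and> (\<forall>t\<ge>0. 1 \<le> \<kappa> t) \<and>
     ((\<lambda>t. \<kappa> t / t) \<longlongrightarrow> 0) at_top"

definition kappa_nbhd ::
    "'a::metric_space \<Rightarrow> (real \<Rightarrow> real) \<Rightarrow> (real \<Rightarrow> 'a) \<Rightarrow> real \<Rightarrow> 'a set" where
  "kappa_nbhd \<oo> \<kappa> \<alpha> m = {x. infdist x (\<alpha> ` {0..}) \<le> m * \<kappa> (dist \<oo> x)}"

text \<open>Since \<^const>\<open>proper_map\<close> does not include continuity, the condition on \<open>m\<close> below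
  just says that preimages of compact sets are compact.\<close>

definition segment_gauge ::
    "'a::metric_space \<Rightarrow> (real \<Rightarrow> real) \<Rightarrow> (real \<Rightarrow> 'a) \<Rightarrow> (real \<times> real \<Rightarrow> real) \<Rightarrow> bool" where
  "segment_gauge \<oo> \<kappa> \<alpha> m \<longleftrightarrow> proper_map euclidean euclidean m \<and>
     (\<forall>q \<beta> u v. u \<le> v \<and> quasi_geodesic_on q {u..v} \<beta> \<and> \<beta> u \<in> \<alpha> ` {0..} \<and> \<beta> v \<in> \<alpha> ` {0..} \<longrightarrow>
        \<beta> ` {u..v} \<subseteq> kappa_nbhd \<oo> \<kappa> \<alpha> (m q))"

definition kappa_morse :: "'a::metric_space \<Rightarrow> (real \<Rightarrow> real) \<Rightarrow> (real \<Rightarrow> 'a) \<Rightarrow> bool" where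
  "kappa_morse \<oo> \<kappa> \<alpha> \<longleftrightarrow> \<alpha> \<in> qg_rays \<oo> \<and> (\<exists>m. segment_gauge \<oo> \<kappa> \<alpha> m)"

definition morse_gauge ::
    "'a::metric_space \<Rightarrow> (real \<Rightarrow> real) \<Rightarrow> (real \<Rightarrow> 'a) \<Rightarrow> (real \<times> real \<Rightarrow> real) \<Rightarrow> bool" where
  "morse_gauge \<oo> \<kappa> \<alpha> m \<longleftrightarrow> segment_gauge \<oo> \<kappa> \<alpha> m \<and>
     (\<forall>\<kappa>' r. sublinear \<kappa>' \<and> 0 < r \<longrightarrow>
        (\<exists>R>0. \<forall>q \<beta>. q_ray \<oo> q \<beta> \<and> m q \<le> r / (2 * \<kappa> r) \<and>
              infdist (point_at \<oo> \<beta> R) (\<alpha> ` {0..}) \<le> \<kappa>' R \<longrightarrow>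
              initial_part \<oo> \<beta> r \<subseteq> kappa_nbhd \<oo> \<kappa> \<alpha> (m q)))"

definition sublin_class :: "'a::metric_space \<Rightarrow> (real \<Rightarrow> 'a) \<Rightarrow> (real \<Rightarrow> 'a) set" where
  "sublin_class \<oo> \<alpha> =
     {\<beta> \<in> qg_rays \<oo>. ((\<lambda>r. dist (point_at \<oo> \<alpha> r) (point_at \<oo> \<beta> r) / r) \<longlongrightarrow> 0) at_top}"

definition kappa_boundary :: "'a::metric_space \<Rightarrow> (real \<Rightarrow> real) \<Rightarrow> (real \<Rightarrow> 'a) set set" where
  "kappa_boundary \<oo> \<kappa> = {sublin_class \<oo> \<alpha> | \<alpha>. kappa_morse \<oo> \<kappa> \<alpha>}"

text \<open>\<open>g a\<close> is the chosen geodesic representative of the class \<open>a\<close> (geodesic rays from \<open>\<oo>\<close> are the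
  \<open>(1, 0)\<close>-rays) and \<open>m a\<close> its chosen Morse gauge.\<close>

definition kappa_central ::
    "'a::metric_space \<Rightarrow> (real \<Rightarrow> real) \<Rightarrow> ((real \<Rightarrow> 'a) set \<Rightarrow> real \<Rightarrow> 'a) \<Rightarrow>
     ((real \<Rightarrow> 'a) set \<Rightarrow> real \<times> real \<Rightarrow> real) \<Rightarrow> bool" where
  "kappa_central \<oo> \<kappa> g m \<longleftrightarrow>
     (\<forall>a\<in>kappa_boundary \<oo> \<kappa>. g a \<in> a \<and> q_ray \<oo> (1, 0) (g a) \<and> morse_gauge \<oo> \<kappa> (g a) (m a))"

definition kappa_boundary_nbhd ::
    "'a::metric_space \<Rightarrow> (real \<Rightarrow> real) \<Rightarrow> ((real \<Rightarrow> 'a) set \<Rightarrow> real \<Rightarrow> 'a) \<Rightarrow>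
     ((real \<Rightarrow> 'a) set \<Rightarrow> real \<times> real \<Rightarrow> real) \<Rightarrow>
     (real \<Rightarrow> 'a) set \<Rightarrow> real \<Rightarrow> (real \<Rightarrow> 'a) set set" where
  "kappa_boundary_nbhd \<oo> \<kappa> g m a r =
     {b \<in> kappa_boundary \<oo> \<kappa>. \<forall>q. \<forall>\<beta>\<in>b. q_ray \<oo> q \<beta> \<and> m a q \<le> r / (2 * \<kappa> r) \<longrightarrow>
        initial_part \<oo> \<beta> r \<subseteq> kappa_nbhd \<oo> \<kappa> (g a) (m a q)}"

end

theory Submission
  imports Defs
begin

text \<open>A ray \<open>\<beta>\<close> that is sublinearly close to \<open>\<sigma>\<close> at a large radius is redirected to \<open>\<sigma>\<close> along a
  geodesic bridge that minimises the distance between \<open>\<beta>\<close> and a slowed-down \<open>\<sigma>\<close>, corrected by the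
  times spent; a Morse geodesic conversely attracts every ray that can be redirected to it. This
  identifies the two kinds of classes. For the topologies one needs the exact constants
  \<open>F(q) = max (f(q) + (1, 1)) (1, q + Q)\<close>. Running along the Morse geodesic at speed \<open>q\<close> shows that
  \<open>f(q)\<close> is at least \<open>q\<close> in the first component, so \<open>(q + 1, Q)\<close> is available for the minimal bridge,
  and the redirection of the Morse geodesic to the central element takes place so late that
  \<open>f(q) + (1, 0)\<close> suffices. A ray with large constants returns to the base point instead; all other
  rays share one pair of constants, which gives a common radius.\<close>

subsection \<open>Quasi-geodesics and first times\<close>

lemma quasi_geodesic_on_lower:
  assumes "quasi_geodesic_on q I \<alpha>" "s \<in> I" "t \<in> I"
  shows "\<bar>t - s\<bar> \<le> fst q * (dist (\<alpha> s) (\<alpha> t) + snd q)"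
proof -
  have "1 \<le> fst q" "\<bar>t - s\<bar> / fst q \<le> dist (\<alpha> s) (\<alpha> t) + snd q"
    using assms by (auto simp: quasi_geodesic_on_def admissible_def algebra_simps)
  then show ?thesis by (simp add: divide_simps mult.commute split: if_splits)
qed

lemma quasi_geodesic_on_upper:
  "quasi_geodesic_on q I \<alpha> \<Longrightarrow> s \<in> I \<Longrightarrow> t \<in> I \<Longrightarrow> dist (\<alpha> s) (\<alpha> t) \<le> fst q * \<bar>t - s\<bar>"
  by (auto simp: quasi_geodesic_on_def)

text \<open>Both bounds are symmetric in the two times, so ordered pairs suffice; this halves the
  case distinctions for spliced paths.\<close>

lemma quasi_geodesic_onI:
  assumes "admissible q"
    and lower: "\<And>s t. s \<in> I \<Longrightarrow> t \<in> I \<Longrightarrow> s \<le> t \<Longrightarrow> t - s \<le> fst q * (dist (\<alpha> s) (\<alpha> t) + snd q)"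
    and upper: "\<And>s t. s \<in> I \<Longrightarrow> t \<in> I \<Longrightarrow> s \<le> t \<Longrightarrow> dist (\<alpha> s) (\<alpha> t) \<le> fst q * (t - s)"
  shows "quasi_geodesic_on q I \<alpha>"
proof -
  have "1 \<le> fst q" using assms(1) by (simp add: admissible_def)
  have *: "(t - s) / fst q - snd q \<le> dist (\<alpha> s) (\<alpha> t)" if "s \<in> I" "t \<in> I" "s \<le> t" for s t
    using lower[OF that] \<open>1 \<le> fst q\<close> by (simp add: field_simps)
  show ?thesis
    unfolding quasi_geodesic_on_def
  proof (intro conjI ballI)
    fix s t assume st: "s \<in> I" "t \<in> I"
    show "\<bar>t - s\<bar> / fst q - snd q \<le> dist (\<alpha> s) (\<alpha> t)"
      using *[of s t] *[of t s] st by (cases "s \<le> t") (auto simp: dist_commute abs_if)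
    show "dist (\<alpha> s) (\<alpha> t) \<le> fst q * \<bar>t - s\<bar>"
      using upper[of s t] upper[of t s] st by (cases "s \<le> t") (auto simp: dist_commute abs_if)
  qed (fact assms(1))
qed

lemma quasi_geodesic_on_mono:
  assumes qg: "quasi_geodesic_on q I \<alpha>" and "fst q \<le> fst q'" "snd q \<le> snd q'" "J \<subseteq> I"
  shows "quasi_geodesic_on q' J \<alpha>"
proof (rule quasi_geodesic_onI)
  have q: "1 \<le> fst q" "0 \<le> snd q"
    using qg by (auto simp: quasi_geodesic_on_def admissible_def)
  then show "admissible q'"
    using assms by (simp add: admissible_def)
  fix s t assume st: "s \<in> J" "t \<in> J" "s \<le> t"
  have "t - s \<le> fst q * (dist (\<alpha> s) (\<alpha> t) + snd q)"
    using quasi_geodesic_on_lower[OF qg, of s t] st assms by auto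
  also have "\<dots> \<le> fst q' * (dist (\<alpha> s) (\<alpha> t) + snd q')"
    using q assms by (intro mult_mono add_mono) auto
  finally show "t - s \<le> fst q' * (dist (\<alpha> s) (\<alpha> t) + snd q')" .
  have "dist (\<alpha> s) (\<alpha> t) \<le> fst q * (t - s)"
    using quasi_geodesic_on_upper[OF qg, of s t] st assms by auto
  also have "\<dots> \<le> fst q' * (t - s)"
    using st assms by (intro mult_right_mono) auto
  finally show "dist (\<alpha> s) (\<alpha> t) \<le> fst q' * (t - s)" .
qed

lemma q_ray_mono:
  "q_ray \<oo> q \<alpha> \<Longrightarrow> fst q \<le> fst q' \<Longrightarrow> snd q \<le> snd q' \<Longrightarrow> q_ray \<oo> q' \<alpha>"
  unfolding q_ray_def using quasi_geodesic_on_mono by blast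

lemma q_ray_admissible: "q_ray \<oo> q \<alpha> \<Longrightarrow> 1 \<le> fst q \<and> 0 \<le> snd q"
  by (simp add: q_ray_def quasi_geodesic_on_def admissible_def)

lemma q_ray_dist_origin:
  assumes "q_ray \<oo> q \<alpha>" "0 \<le> t"
  shows "t \<le> fst q * (dist \<oo> (\<alpha> t) + snd q)" "dist \<oo> (\<alpha> t) \<le> fst q * t"
  using quasi_geodesic_on_lower[of q "{0..}" \<alpha> 0 t] quasi_geodesic_on_upper[of q "{0..}" \<alpha> 0 t]
    assms by (auto simp: q_ray_def)

lemma q_ray_continuous_on:
  assumes "q_ray \<oo> q \<alpha>"
  shows "continuous_on {0..} \<alpha>"
proof -
  have "(fst q)-lipschitz_on {0..} \<alpha>"
    using assms q_ray_admissible[OF assms] quasi_geodesic_on_upper[of q "{0..}" \<alpha>]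
    by (intro lipschitz_onI) (auto simp: q_ray_def dist_real_def abs_minus_commute)
  then show ?thesis by (rule lipschitz_on_continuous_on)
qed

section \<open>First times and initial parts of rays\<close>

lemma first_time_least:
  fixes r :: real
  assumes ray: "q_ray \<oo> q \<alpha>"
  defines "t \<equiv> first_time \<oo> \<alpha> r"
  shows "0 \<le> t" "r \<le> dist \<oo> (\<alpha> t)" "\<And>s. 0 \<le> s \<Longrightarrow> r \<le> dist \<oo> (\<alpha> s) \<Longrightarrow> t \<le> s"
proof -
  let ?A = "{s. 0 \<le> s \<and> r \<le> dist \<oo> (\<alpha> s)}"
  have q: "1 \<le> fst q" "0 \<le> snd q" using q_ray_admissible[OF ray] by auto
  \<comment> \<open>The lower quasi-geodesic bound gives norm at least \<open>\<bar>r\<bar>\<close>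
    at this time, so the \<open>LEAST\<close> ranges over a nonempty closed set.\<close>
  define T where "T = fst q * (\<bar>r\<bar> + snd q)"
  have "0 \<le> T" using q by (simp add: T_def)
  moreover have "r \<le> dist \<oo> (\<alpha> T)"
  proof -
    have "fst q * (\<bar>r\<bar> + snd q) \<le> fst q * (dist \<oo> (\<alpha> T) + snd q)"
      using q_ray_dist_origin(1)[OF ray \<open>0 \<le> T\<close>] by (simp add: T_def)
    then show ?thesis using q by auto
  qed
  ultimately have ne: "?A \<noteq> {}" by blast
  have "continuous_on {0..} (\<lambda>s. dist \<oo> (\<alpha> s))"
    by (intro continuous_intros q_ray_continuous_on[OF ray])
  then have "closed ({0..} \<inter> (\<lambda>s. dist \<oo> (\<alpha> s)) -` {r..})"
    by (rule continuous_closed_preimage) auto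
  also have "{0..} \<inter> (\<lambda>s. dist \<oo> (\<alpha> s)) -` {r..} = ?A" by auto
  finally have cl: "closed ?A" .
  have bdd: "bdd_below ?A" by (rule bdd_belowI[of _ 0]) auto
  have "Inf ?A \<in> ?A" by (rule closed_contains_Inf[OF ne bdd cl])
  moreover have "Inf ?A \<le> s" if "s \<in> ?A" for s
    using that bdd by (rule cInf_lower)
  moreover have "t = Inf ?A"
    unfolding t_def first_time_def using calculation by (intro Least_equality) auto
  ultimately show "0 \<le> t" "r \<le> dist \<oo> (\<alpha> t)" "\<And>s. 0 \<le> s \<Longrightarrow> r \<le> dist \<oo> (\<alpha> s) \<Longrightarrow> t \<le> s"
    by auto
qed

lemma dist_point_at:
  assumes ray: "q_ray \<oo> q \<alpha>" and "0 \<le> r"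
  shows "dist \<oo> (point_at \<oo> \<alpha> r) = r"
proof -
  let ?t = "first_time \<oo> \<alpha> r"
  note ft = first_time_least[OF ray, where r = r]
  have "continuous_on {0..?t} (\<lambda>s. dist \<oo> (\<alpha> s))"
    by (intro continuous_intros continuous_on_subset[OF q_ray_continuous_on[OF ray]]) auto
  moreover have "dist \<oo> (\<alpha> 0) = 0" using ray by (simp add: q_ray_def)
  ultimately obtain s where s: "0 \<le> s" "s \<le> ?t" "dist \<oo> (\<alpha> s) = r"
    using IVT'[of "\<lambda>s. dist \<oo> (\<alpha> s)" 0 r ?t] ft(1,2) assms(2) by auto
  then have "s = ?t" using ft(3)[of s] by auto
  then show ?thesis using s by (simp add: point_at_def)
qed

lemma first_time_bounds:
  assumes ray: "q_ray \<oo> q \<alpha>" and "0 \<le> r"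
  shows "first_time \<oo> \<alpha> r \<le> fst q * (r + snd q)" "r \<le> fst q * first_time \<oo> \<alpha> r"
  using q_ray_dist_origin[OF ray first_time_least(1)[OF ray, of r]] dist_point_at[OF assms]
  by (simp_all add: point_at_def)

text \<open>Equality on the initial interval forces equal first times: there both paths have the
  same norms, and before its end neither reaches \<open>r\<close>.\<close>

lemma agree_up_toI:
  assumes ray: "q_ray \<oo> q \<alpha>" and eq: "\<And>t. 0 \<le> t \<Longrightarrow> t \<le> first_time \<oo> \<alpha> r \<Longrightarrow> \<gamma> t = \<alpha> t"
  shows "agree_up_to \<oo> \<gamma> \<alpha> r"
proof -
  note ft = first_time_least[OF ray, where r = r]
  have "first_time \<oo> \<gamma> r = first_time \<oo> \<alpha> r"
    unfolding first_time_def[of \<oo> \<gamma>]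
  proof (rule Least_equality)
    show "0 \<le> first_time \<oo> \<alpha> r \<and> r \<le> dist \<oo> (\<gamma> (first_time \<oo> \<alpha> r))"
      using ft eq by auto
    fix s assume s: "0 \<le> s \<and> r \<le> dist \<oo> (\<gamma> s)"
    show "first_time \<oo> \<alpha> r \<le> s"
    proof (rule ccontr)
      assume "\<not> first_time \<oo> \<alpha> r \<le> s"
      then show False using ft(3)[of s] eq[of s] s by auto
    qed
  qed
  then show ?thesis using eq by (simp add: agree_up_to_def)
qed

lemma first_time_geodesic_ray:
  assumes "q_ray \<oo> (1, 0) g" "0 \<le> r"
  shows "first_time \<oo> g r = r"
  using first_time_bounds[OF assms] by simp

lemma dist_geodesic_ray:
  assumes "q_ray \<oo> (1, 0) g" "0 \<le> s" "0 \<le> t"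
  shows "dist (g s) (g t) = \<bar>t - s\<bar>"
  using assms quasi_geodesic_on_lower[of "(1,0)" "{0..}" g s t]
    quasi_geodesic_on_upper[of "(1,0)" "{0..}" g s t] by (auto simp: q_ray_def)

lemma redirectable_refl:
  assumes ray: "q_ray \<oo> q \<alpha>"
  shows "redirectable \<oo> q \<alpha> \<alpha>"
proof -
  have "eventually_coincides \<alpha> \<alpha>"
    unfolding eventually_coincides_def by (intro exI[of _ 1] exI[of _ 0] conjI) auto
  then show ?thesis
    using ray agree_up_toI[OF ray, of _ \<alpha>] by (auto simp: redirectable_def redirectable_at_def)
qed


subsection \<open>Surgery\<close>

text \<open>The second piece is reached at a very large radius only; there the increase of the
  multiplicative constant from \<open>fst f\<close> to \<open>fst f + 1\<close> absorbs every constant produced by the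
  initial part.\<close>

lemma late_splice:
  assumes \<eta>: "q_ray \<oo> F \<eta>" and \<sigma>: "q_ray \<oo> p \<sigma>"
    and lam: "0 < lam" "lam \<le> 1"
    and \<eta>\<sigma>: "\<And>t. T \<le> t \<Longrightarrow> 0 \<le> lam * t + c \<and> \<eta> t = \<sigma> (lam * t + c)"
    and red: "redirectable \<oo> f \<sigma> \<tau>"
    and fF: "fst f + 1 \<le> fst F" "snd f \<le> snd F"
  obtains \<gamma> where "q_ray \<oo> F \<gamma>" "\<And>t. t \<le> S \<Longrightarrow> \<gamma> t = \<eta> t" "eventually_coincides \<gamma> \<tau>"
proof -
  \<comment> \<open>The splice comes after \<open>S\<close>, to keep the prescribed initial part,
    and after \<open>T\<close>, when \<open>\<eta>\<close> already runs along
    \<open>\<sigma>\<close>.\<close>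
  define T' where "T' = max 0 (max T S)"
  define a where "a = lam * T' + c"
  \<comment> \<open>\<open>K\<close> collects the constants caused by the part before
    \<open>T'\<close>, and \<open>R\<close> is so large that \<open>\<sigma>\<close> reaches it only
    after parameter \<open>(fst f + 1) * K + a\<close>. The absolute value in \<open>R\<close> gives
    \<open>0 < R\<close> before \<open>1 \<le> fst f\<close> is known, which comes from
    \<open>\<rho>\<close>.\<close>
  define K where "K = T' + fst f * (fst F * T')"
  define R where "R = fst p * (\<bar>(fst f + 1) * K\<bar> + a + 1)"
  have T': "0 \<le> T'" "T \<le> T'" "S \<le> T'" by (auto simp: T'_def)
  have a: "0 \<le> a" "\<eta> T' = \<sigma> a" using \<eta>\<sigma>[OF T'(2)] by (auto simp: a_def)
  have p: "1 \<le> fst p" using q_ray_admissible[OF \<sigma>] by simp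
  have "0 < R" using p a by (auto simp: R_def intro!: mult_pos_pos)
  obtain \<rho> where \<rho>: "q_ray \<oo> f \<rho>" "agree_up_to \<oo> \<rho> \<sigma> R" "eventually_coincides \<rho> \<tau>"
    using red \<open>0 < R\<close> unfolding redirectable_def redirectable_at_def by blast
  define X where "X = first_time \<oo> \<sigma> R"
  have "R \<le> fst p * X"
    using first_time_bounds(2)[OF \<sigma>, of R] \<open>0 < R\<close> by (simp add: X_def)
  then have X: "(fst f + 1) * K + a \<le> X" "a \<le> X"
    using p by (auto simp: R_def)
  have \<rho>\<sigma>: "\<rho> x = \<sigma> x" if "0 \<le> x" "x \<le> X" for x
    using \<rho>(2) that by (auto simp: agree_up_to_def X_def)
  have f: "1 \<le> fst f" "0 \<le> snd f" using q_ray_admissible[OF \<rho>(1)] by auto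
  have F: "1 \<le> fst F" "0 \<le> snd F" using q_ray_admissible[OF \<eta>] by auto
  define \<gamma> where "\<gamma> = (\<lambda>t. if t \<le> T' then \<eta> t else \<rho> (a + (t - T')))"
  have \<gamma>1: "\<gamma> t = \<eta> t" if "t \<le> T'" for t using that by (simp add: \<gamma>_def)
  have \<gamma>2: "\<gamma> t = \<rho> (a + (t - T'))" if "T' \<le> t" for t
    using that a X \<rho>\<sigma>[of a] by (auto simp: \<gamma>_def)
  have \<eta>qg: "quasi_geodesic_on F {0..} \<eta>" using \<eta> by (simp add: q_ray_def)
  have \<rho>qg: "quasi_geodesic_on F {0..} \<rho>"
    using \<rho>(1) fF quasi_geodesic_on_mono[of f "{0..}" \<rho> F "{0..}"] by (simp add: q_ray_def)
  have "quasi_geodesic_on F {0..} \<gamma>"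
  proof (rule quasi_geodesic_onI)
    show "admissible F" using F by (simp add: admissible_def)
  next
    fix s t :: real assume st: "s \<in> {0..}" "t \<in> {0..}" "s \<le> t"
    consider "t \<le> T'" | "T' \<le> s" | "s \<le> T'" "T' \<le> t" by linarith
    then show "dist (\<gamma> s) (\<gamma> t) \<le> fst F * (t - s)"
    proof cases
      case 1 then show ?thesis
        using quasi_geodesic_on_upper[OF \<eta>qg, of s t] st by (simp add: \<gamma>1)
    next
      case 2 then show ?thesis
        using quasi_geodesic_on_upper[OF \<rho>qg, of "a + (s - T')" "a + (t - T')"] st a
        by (simp add: \<gamma>2)
    next
      case 3
      have "dist (\<gamma> s) (\<gamma> T') \<le> fst F * (T' - s)"
        using quasi_geodesic_on_upper[OF \<eta>qg, of s T'] st 3 T' by (simp add: \<gamma>1)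
      moreover have "dist (\<gamma> T') (\<gamma> t) \<le> fst F * (t - T')"
        using quasi_geodesic_on_upper[OF \<rho>qg, of "a" "a + (t - T')"] st a 3 by (simp add: \<gamma>2)
      ultimately show ?thesis
        using dist_triangle[of "\<gamma> s" "\<gamma> t" "\<gamma> T'"] by (simp add: algebra_simps)
    qed
  next
    fix s t :: real assume st: "s \<in> {0..}" "t \<in> {0..}" "s \<le> t"
    consider "t \<le> T'" | "T' \<le> s" | "s \<le> T'" "T' \<le> t" "a + (t - T') \<le> X"
      | "s \<le> T'" "T' \<le> t" "X \<le> a + (t - T')" by linarith
    then show "t - s \<le> fst F * (dist (\<gamma> s) (\<gamma> t) + snd F)"
    proof cases
      case 1 then show ?thesis
        using quasi_geodesic_on_lower[OF \<eta>qg, of s t] st by (simp add: \<gamma>1)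
    next
      case 2 then show ?thesis
        using quasi_geodesic_on_lower[OF \<rho>qg, of "a + (s - T')" "a + (t - T')"] st a
        by (simp add: \<gamma>2)
    next
      case 3
      \<comment> \<open>Up to \<open>X\<close> the path still traverses \<open>\<sigma>\<close>, and
        \<open>\<eta>\<close>, slowed by \<open>lam\<close>, visits \<open>\<gamma> t\<close> at the
        time \<open>t' \<ge> t\<close>. Its lower bound for \<open>s\<close> and \<open>t'\<close>
        is therefore enough.\<close>
      define t' where "t' = T' + (t - T') / lam"
      have "t - T' \<le> (t - T') / lam"
        using 3 lam mult_left_le[of lam "t - T'"] by (simp add: pos_le_divide_eq)
      then have t': "t \<le> t'" "T' \<le> t'" using 3 by (auto simp: t'_def)
      have "lam * t' + c = a + (t - T')"
        using lam by (simp add: t'_def a_def field_simps)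
      then have "\<eta> t' = \<gamma> t"
        using \<eta>\<sigma>[of t'] t' T' 3 a \<rho>\<sigma>[of "a + (t - T')"] by (simp add: \<gamma>2)
      then show ?thesis
        using quasi_geodesic_on_lower[OF \<eta>qg, of s t'] st 3 t' by (simp add: \<gamma>1)
    next
      case 4
      define x where "x = a + (t - T')"
      define d where "d = dist (\<gamma> s) (\<gamma> t)"
      have "dist \<oo> (\<eta> s) \<le> fst F * s"
        using q_ray_dist_origin(2)[OF \<eta>, of s] st by simp
      also have "\<dots> \<le> fst F * T'" using 4 F by (intro mult_left_mono) auto
      finally have "dist \<oo> (\<rho> x) \<le> fst F * T' + d"
        using dist_triangle[of \<oo> "\<rho> x" "\<gamma> s"] 4 by (simp add: x_def d_def \<gamma>1 \<gamma>2)
      moreover have "x \<le> fst f * (dist \<oo> (\<rho> x) + snd f)"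
        using q_ray_dist_origin(1)[OF \<rho>(1), of x] 4 a by (simp add: x_def)
      ultimately have "x \<le> fst f * (fst F * T' + d + snd f)"
        using f by (smt (verit) mult_left_mono)
      then have 1: "t - K \<le> fst f * (d + snd f)"
        using a by (simp add: x_def K_def algebra_simps)
      \<comment> \<open>Since \<open>K\<close> is at most the fraction
        \<open>1 / (fst f + 1)\<close> of \<open>t\<close>, removing it costs exactly the passage
        from \<open>fst f\<close> to \<open>fst f + 1\<close>.\<close>
      have "(fst f + 1) * K \<le> t" using 4 X T' by simp
      then have "fst f * t \<le> (fst f + 1) * (t - K)" by (simp add: algebra_simps)
      also have "\<dots> \<le> (fst f + 1) * (fst f * (d + snd f))"
        using 1 f by (intro mult_left_mono) auto
      finally have "fst f * t \<le> fst f * ((fst f + 1) * (d + snd f))" by (simp add: algebra_simps)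
      then have "t \<le> (fst f + 1) * (d + snd f)" using f by simp
      also have "\<dots> \<le> fst F * (d + snd F)"
        using fF f by (intro mult_mono) (auto simp: d_def)
      finally show ?thesis using st by (simp add: d_def)
    qed
  qed
  moreover have "\<gamma> 0 = \<oo>" using \<gamma>1[of 0] T' \<eta> by (simp add: q_ray_def)
  ultimately have "q_ray \<oo> F \<gamma>" by (simp add: q_ray_def)
  moreover have "\<gamma> t = \<eta> t" if "t \<le> S" for t using that T' by (simp add: \<gamma>1)
  moreover have "eventually_coincides \<gamma> \<tau>"
  proof -
    obtain u v where uv: "u > 0" "\<And>t. t \<ge> u \<Longrightarrow> 0 \<le> t + v \<and> \<rho> t = \<tau> (t + v)"
      using \<rho>(3) unfolding eventually_coincides_def by blast
    show ?thesis
      unfolding eventually_coincides_def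
    proof (intro exI conjI allI impI)
      show "0 < u + T'" using uv T' by simp
      fix t assume t: "u + T' \<le> t"
      show "0 \<le> t + (a - T' + v)" "\<gamma> t = \<tau> (t + (a - T' + v))"
        using uv(2)[of "a + (t - T')"] t a uv(1) by (auto simp: \<gamma>2 algebra_simps)
    qed
  qed
  ultimately show thesis by (rule that)
qed

text \<open>The first redirecting ray ends on \<open>\<sigma>\<close>, so \<open>late_splice\<close>
  with \<open>lam = 1\<close> applies; only \<open>fst f\<close> has to be increased.\<close>

lemma redirectable_at_trans:
  assumes "redirectable_at \<oo> p \<alpha> \<sigma> r" and \<sigma>: "q_ray \<oo> q \<sigma>" and \<alpha>: "q_ray \<oo> q' \<alpha>"
    and red: "redirectable \<oo> f \<sigma> \<tau>"
  shows "redirectable_at \<oo> (max (fst p) (fst f + 1), max (snd p) (snd f)) \<alpha> \<tau> r"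
proof -
  let ?F = "(max (fst p) (fst f + 1), max (snd p) (snd f))"
  obtain \<eta> where \<eta>: "q_ray \<oo> p \<eta>" "agree_up_to \<oo> \<eta> \<alpha> r" "eventually_coincides \<eta> \<sigma>"
    using assms(1) by (auto simp: redirectable_at_def)
  obtain T c where Tc: "\<And>t. t \<ge> T \<Longrightarrow> 0 \<le> t + c \<and> \<eta> t = \<sigma> (t + c)"
    using \<eta>(3) unfolding eventually_coincides_def by blast
  have "q_ray \<oo> ?F \<eta>" using q_ray_mono[OF \<eta>(1)] by simp
  then obtain \<gamma> where \<gamma>: "q_ray \<oo> ?F \<gamma>" "\<And>t. t \<le> first_time \<oo> \<alpha> r \<Longrightarrow> \<gamma> t = \<eta> t"
      "eventually_coincides \<gamma> \<tau>"
    using late_splice[of \<oo> ?F \<eta> q \<sigma> 1 T c f \<tau> "first_time \<oo> \<alpha> r"] \<sigma> Tc red by auto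
  moreover have "agree_up_to \<oo> \<gamma> \<alpha> r"
    using \<gamma>(2) \<eta>(2) by (intro agree_up_toI[OF \<alpha>]) (auto simp: agree_up_to_def)
  ultimately show ?thesis by (auto simp: redirectable_at_def)
qed

lemma qr_le_trans:
  assumes "qr_le \<oo> \<alpha> \<beta>" "qr_le \<oo> \<beta> \<gamma>" "\<alpha> \<in> qg_rays \<oo>" "\<beta> \<in> qg_rays \<oo>"
  shows "qr_le \<oo> \<alpha> \<gamma>"
proof -
  obtain p f q q' where "redirectable \<oo> p \<alpha> \<beta>" "redirectable \<oo> f \<beta> \<gamma>"
    "q_ray \<oo> q \<alpha>" "q_ray \<oo> q' \<beta>"
    using assms by (auto simp: qr_le_def qg_rays_def)
  then show ?thesis
    unfolding qr_le_def redirectable_def using redirectable_at_trans[of \<oo> p \<alpha> \<beta> _ q' q f \<gamma>]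
    by (metis redirectable_def)
qed

section \<open>Geodesic bridges from one ray to another\<close>

lemma lipschitz_concat:
  fixes \<alpha> :: "real \<Rightarrow> 'a::metric_space"
  assumes "\<And>s t. a \<le> s \<Longrightarrow> s \<le> t \<Longrightarrow> t \<le> b \<Longrightarrow> dist (\<alpha> s) (\<alpha> t) \<le> L * (t - s)"
    and "\<And>s t. b \<le> s \<Longrightarrow> s \<le> t \<Longrightarrow> dist (\<alpha> s) (\<alpha> t) \<le> L * (t - s)"
    and "a \<le> s" "s \<le> t"
  shows "dist (\<alpha> s) (\<alpha> t) \<le> L * (t - s)"
proof -
  consider "t \<le> b" | "b \<le> s" | "s \<le> b" "b \<le> t" by linarith
  then show ?thesis
  proof cases
    case 3
    then have "dist (\<alpha> s) (\<alpha> b) \<le> L * (b - s)" "dist (\<alpha> b) (\<alpha> t) \<le> L * (t - b)"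
      using assms by auto
    then show ?thesis
      using dist_triangle[of "\<alpha> s" "\<alpha> t" "\<alpha> b"] by (simp add: algebra_simps)
  qed (use assms in auto)
qed

text \<open>\<open>\<eta>\<close> follows \<open>\<beta>\<close> up to \<open>s0\<close>, crosses
  along a unit-speed geodesic, then follows \<open>\<sigma>\<close> at speed \<open>lam\<close>.
  \<open>optimal\<close> controls pairs of times on both sides of the bridge; points on the bridge
  are reduced to it by the triangle inequality, which is why the bridge length carries the weight
  \<open>fst G\<close>. Slowing down turns \<open>fst q'\<close> into \<open>fst q' / lam\<close> in
  the lower bound on \<open>\<sigma>\<close>.\<close>

lemma bridge:
  fixes \<beta> \<sigma> :: "real \<Rightarrow> 'a::metric_space"
  assumes space: "proper_geodesic_space TYPE('a)"
    and \<beta>: "q_ray \<oo> q \<beta>" and \<sigma>: "q_ray \<oo> q' \<sigma>"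
    and qG: "fst q \<le> fst G" "snd q \<le> snd G" "fst q' \<le> lam * fst G" "snd q' \<le> snd G"
    and lam: "0 < lam" "lam \<le> 1" and s0: "0 \<le> s0" and u0: "0 \<le> u0"
    and optimal: "\<And>s u. 0 \<le> s \<Longrightarrow> s \<le> s0 \<Longrightarrow> u0 \<le> u \<Longrightarrow>
      fst G * dist (\<beta> s0) (\<sigma> (lam * u0)) + (s0 - s) + (u - u0)
        \<le> fst G * (dist (\<beta> s) (\<sigma> (lam * u)) + snd G)"
  obtains \<eta> c T where "q_ray \<oo> G \<eta>" "\<And>t. t \<le> s0 \<Longrightarrow> \<eta> t = \<beta> t"
    "\<And>t. T \<le> t \<Longrightarrow> 0 \<le> lam * t + c \<and> \<eta> t = \<sigma> (lam * t + c)"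
proof -
  define D where "D = dist (\<beta> s0) (\<sigma> (lam * u0))"
  obtain h where h: "h 0 = \<beta> s0" "h D = \<sigma> (lam * u0)"
      "\<And>s t. s \<in> {0..D} \<Longrightarrow> t \<in> {0..D} \<Longrightarrow> dist (h s) (h t) = \<bar>s - t\<bar>"
    using space unfolding proper_geodesic_space_def D_def by meson
  have D: "0 \<le> D" by (simp add: D_def)
  define b where "b = s0 + D"
  define \<eta> where "\<eta> = (\<lambda>t. if t \<le> s0 then \<beta> t else if t \<le> b then h (t - s0)
                         else \<sigma> (lam * (u0 + (t - b))))"
  have \<eta>1: "\<eta> t = \<beta> t" if "t \<le> s0" for t using that by (simp add: \<eta>_def)
  have \<eta>2: "\<eta> t = h (t - s0)" if "s0 \<le> t" "t \<le> b" for t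
    using that h(1) by (cases "t = s0") (auto simp: \<eta>_def)
  have \<eta>3: "\<eta> t = \<sigma> (lam * (u0 + (t - b)))" if "b \<le> t" for t
    using that h(2) D \<eta>2[of b] by (cases "t = b") (auto simp: \<eta>_def b_def)
  have q: "1 \<le> fst q" "0 \<le> snd q" using q_ray_admissible[OF \<beta>] by auto
  have q': "1 \<le> fst q'" "0 \<le> snd q'" using q_ray_admissible[OF \<sigma>] by auto
  have G: "1 \<le> fst G" "0 \<le> snd G" using q qG by auto
  have \<beta>qg: "quasi_geodesic_on G {0..} \<beta>"
    using \<beta> quasi_geodesic_on_mono[OF _ qG(1,2), of "{0..}" \<beta> "{0..}"] by (simp add: q_ray_def)
  have \<sigma>qg: "quasi_geodesic_on q' {0..} \<sigma>" using \<sigma> by (simp add: q_ray_def)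
  have pos: "0 \<le> lam * (u0 + (t - b))" if "b \<le> t" for t using that lam u0 by simp
  have \<eta>3_upper: "dist (\<eta> s) (\<eta> t) \<le> fst G * (t - s)" if "b \<le> s" "s \<le> t" for s t
  proof -
    have "dist (\<eta> s) (\<eta> t) \<le> fst q' * (lam * (t - s))"
      using quasi_geodesic_on_upper[OF \<sigma>qg, of "lam * (u0 + (s - b))" "lam * (u0 + (t - b))"]
        that pos[of s] pos[of t] lam
      by (simp add: \<eta>3 abs_mult flip: right_diff_distrib)
    also have "\<dots> \<le> fst G * (t - s)"
    proof -
      have "fst q' * lam \<le> fst q'" using q' lam by (simp add: mult_left_le)
      also have "\<dots> \<le> fst G" using qG(3) lam G mult_right_mono[of lam 1 "fst G"] by linarith
      finally show ?thesis using that by (simp add: mult_right_mono flip: mult.assoc)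
    qed
    finally show ?thesis .
  qed
  have \<eta>2_dist: "dist (\<eta> s) (\<eta> t) = t - s" if "s0 \<le> s" "s \<le> t" "t \<le> b" for s t
    using h(3)[of "s - s0" "t - s0"] that by (simp add: \<eta>2 b_def)
  have scale: "x \<le> fst G * x" if "0 \<le> x" for x
    using G that by (simp add: mult_le_cancel_right1)
  have "quasi_geodesic_on G {0..} \<eta>"
  proof (rule quasi_geodesic_onI)
    show "admissible G" using G by (simp add: admissible_def)
  next
    fix s t :: real assume st: "s \<in> {0..}" "t \<in> {0..}" "s \<le> t"
    have 1: "dist (\<eta> s) (\<eta> t) \<le> fst G * (t - s)" if "s0 \<le> s" "s \<le> t" for s t
      by (rule lipschitz_concat[of s0 b, OF _ \<eta>3_upper that]) (simp_all add: \<eta>2_dist scale)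
    have 2: "dist (\<eta> s) (\<eta> t) \<le> fst G * (t - s)" if "0 \<le> s" "s \<le> t" "t \<le> s0" for s t
      using quasi_geodesic_on_upper[OF \<beta>qg, of s t] that by (simp add: \<eta>1)
    show "dist (\<eta> s) (\<eta> t) \<le> fst G * (t - s)"
      by (rule lipschitz_concat[of 0 s0, OF 2 1]) (use st in auto)
  next
    fix s t :: real assume st: "s \<in> {0..}" "t \<in> {0..}" "s \<le> t"
    have GG: "0 \<le> fst G * snd G" using G by simp
    consider (bb) "t \<le> s0" | (bh) "s \<le> s0" "s0 \<le> t" "t \<le> b" | (bs) "s \<le> s0" "b \<le> t"
      | (hh) "s0 \<le> s" "t \<le> b" | (hs) "s0 \<le> s" "s \<le> b" "b \<le> t" | (ss) "b \<le> s" by linarith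
    then show "t - s \<le> fst G * (dist (\<eta> s) (\<eta> t) + snd G)"
    proof cases
      case bb then show ?thesis
        using quasi_geodesic_on_lower[OF \<beta>qg, of s t] st by (simp add: \<eta>1)
    next
      case bh
      \<comment> \<open>Going on to the far end of the bridge allows \<open>optimal\<close> at
        \<open>u = u0\<close>; the weighted bridge length absorbs the detour. The case
        \<open>hs\<close> is the mirror image with \<open>s = s0\<close>.\<close>
      have "dist (\<beta> s) (\<sigma> (lam * u0)) \<le> dist (\<eta> s) (\<eta> t) + (b - t)"
        using dist_triangle[of "\<eta> s" "\<eta> b" "\<eta> t"] \<eta>2_dist[of t b] bh by (simp add: \<eta>1 \<eta>3)
      then have "fst G * dist (\<beta> s) (\<sigma> (lam * u0)) \<le> fst G * (dist (\<eta> s) (\<eta> t) + (b - t))"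
        using G by (intro mult_left_mono) auto
      then show ?thesis
        using optimal[of s u0] st bh scale[of "t - s0"] by (simp add: algebra_simps b_def flip: D_def)
    next
      case bs
      then show ?thesis
        using optimal[of s "u0 + (t - b)"] st scale[OF D]
        by (simp add: \<eta>1 \<eta>3 b_def flip: D_def)
    next
      case hh then show ?thesis
        using st scale[of "t - s"] GG by (simp add: \<eta>2_dist algebra_simps)
    next
      case hs
      have "dist (\<beta> s0) (\<sigma> (lam * (u0 + (t - b)))) \<le> (s - s0) + dist (\<eta> s) (\<eta> t)"
        using dist_triangle[of "\<eta> s0" "\<eta> t" "\<eta> s"] \<eta>2_dist[of s0 s] hs by (simp add: \<eta>1 \<eta>3)
      then have "fst G * dist (\<beta> s0) (\<sigma> (lam * (u0 + (t - b))))
          \<le> fst G * ((s - s0) + dist (\<eta> s) (\<eta> t))"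
        using G by (intro mult_left_mono) auto
      then show ?thesis
        using optimal[of s0 "u0 + (t - b)"] s0 hs scale[of "b - s"]
        by (simp add: algebra_simps b_def flip: D_def)
    next
      case ss
      have "lam * (t - s) \<le> fst q' * (dist (\<eta> s) (\<eta> t) + snd q')"
        using quasi_geodesic_on_lower[OF \<sigma>qg, of "lam * (u0 + (s - b))" "lam * (u0 + (t - b))"]
          ss st pos[of s] pos[of t] lam
        by (simp add: \<eta>3 abs_mult flip: right_diff_distrib)
      also have "\<dots> \<le> (lam * fst G) * (dist (\<eta> s) (\<eta> t) + snd G)"
        using qG q' by (intro mult_mono) auto
      finally show ?thesis using lam by (simp add: mult.assoc)
    qed
  qed
  moreover have "\<eta> 0 = \<oo>" using \<eta>1[of 0] s0 \<beta> by (simp add: q_ray_def)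
  ultimately have "q_ray \<oo> G \<eta>" by (simp add: q_ray_def)
  moreover have "0 \<le> lam * t + lam * (u0 - b) \<and> \<eta> t = \<sigma> (lam * t + lam * (u0 - b))"
    if "b \<le> t" for t
    using pos[OF that] \<eta>3[OF that] by (simp add: algebra_simps)
  ultimately show thesis using \<eta>1 that by blast
qed

text \<open>The bridge leaves \<open>\<beta>\<close> only after radius \<open>r\<close> is reached,
  and the redirection from \<open>\<sigma>\<close> to \<open>\<tau>\<close> is spliced in later
  still. The bridge may use constants \<open>G\<close> smaller than \<open>F\<close>.\<close>

lemma redirectable_at_bridge:
  fixes \<beta> \<sigma> :: "real \<Rightarrow> 'a::metric_space"
  assumes "proper_geodesic_space TYPE('a)"
    and \<beta>: "q_ray \<oo> q \<beta>" and \<sigma>: "q_ray \<oo> q' \<sigma>"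
    and "fst q \<le> fst G" "snd q \<le> snd G" "fst q' \<le> lam * fst G" "snd q' \<le> snd G"
    and lam: "0 < lam" "lam \<le> 1" and s0: "first_time \<oo> \<beta> r \<le> s0" and "0 \<le> u0"
    and "\<And>s u. 0 \<le> s \<Longrightarrow> s \<le> s0 \<Longrightarrow> u0 \<le> u \<Longrightarrow>
      fst G * dist (\<beta> s0) (\<sigma> (lam * u0)) + (s0 - s) + (u - u0)
        \<le> fst G * (dist (\<beta> s) (\<sigma> (lam * u)) + snd G)"
    and GF: "fst G \<le> fst F" "snd G \<le> snd F"
    and red: "redirectable \<oo> f \<sigma> \<tau>" and fF: "fst f + 1 \<le> fst F" "snd f \<le> snd F"
  shows "redirectable_at \<oo> F \<beta> \<tau> r"
proof -
  have "0 \<le> s0" using s0 first_time_least(1)[OF \<beta>, of r] by simp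
  then obtain \<eta> c T where \<eta>: "q_ray \<oo> G \<eta>" "\<And>t. t \<le> s0 \<Longrightarrow> \<eta> t = \<beta> t"
    "\<And>t. T \<le> t \<Longrightarrow> 0 \<le> lam * t + c \<and> \<eta> t = \<sigma> (lam * t + c)"
    using bridge[of \<oo> q \<beta> q' \<sigma> G lam s0 u0] assms by metis
  obtain \<gamma> where \<gamma>: "q_ray \<oo> F \<gamma>" "\<And>t. t \<le> s0 \<Longrightarrow> \<gamma> t = \<eta> t" "eventually_coincides \<gamma> \<tau>"
    using late_splice[OF q_ray_mono[OF \<eta>(1) GF] \<sigma> lam \<eta>(3) red fF] by metis
  have "agree_up_to \<oo> \<gamma> \<beta> r"
    using \<gamma>(2) \<eta>(2) s0 by (intro agree_up_toI[OF \<beta>]) auto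
  then show ?thesis using \<gamma> by (auto simp: redirectable_at_def)
qed

text \<open>Minimising \<open>L * dist (\<beta> s) (\<sigma> (lam * u)) + s - u\<close> over all pairs of times gives a bridge
  from \<open>\<beta>\<close> to \<open>\<sigma>\<close> satisfying the hypothesis of the previous lemma without any additive constant.
  Since \<open>\<sigma>\<close> is slowed down by the factor \<open>lam\<close>, the function is very negative wherever
  \<open>\<beta>\<close> is close to \<open>\<sigma>\<close> far out, which forces the minimum away from the origin.\<close>

lemma minimal_bridge:
  fixes \<beta> \<sigma> :: "real \<Rightarrow> 'a::metric_space"
  assumes \<beta>: "q_ray \<oo> q \<beta>" and \<sigma>: "q_ray \<oo> q' \<sigma>"
    and lam: "0 < lam" "fst q' < lam * L" and "0 \<le> r" "0 \<le> a" "0 \<le> b"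
    and ab: "L * dist (\<beta> a) (\<sigma> (lam * b)) + a - b < - L * (r + snd q')"
  obtains s0 u0 where "first_time \<oo> \<beta> r \<le> s0" "0 \<le> u0"
    "\<And>s u. 0 \<le> s \<Longrightarrow> s \<le> s0 \<Longrightarrow> u0 \<le> u \<Longrightarrow>
      L * dist (\<beta> s0) (\<sigma> (lam * u0)) + (s0 - s) + (u - u0) \<le> L * dist (\<beta> s) (\<sigma> (lam * u))"
proof -
  define \<Psi> where "\<Psi> = (\<lambda>(s, u). L * dist (\<beta> s) (\<sigma> (lam * u)) + s - u)"
  \<comment> \<open>Even slowed by \<open>lam\<close>, \<open>\<sigma>\<close> escapes linearly: the
    distance term weighted by \<open>L\<close> grows in \<open>u\<close> at rate
    \<open>e > 1\<close> and outweighs \<open>- u\<close>.\<close>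
  define e where "e = L * lam / fst q'"
  have q: "1 \<le> fst q" "0 \<le> snd q" using q_ray_admissible[OF \<beta>] by auto
  have q': "1 \<le> fst q'" "0 \<le> snd q'" using q_ray_admissible[OF \<sigma>] by auto
  have e: "1 < e" using lam q' by (simp add: e_def mult.commute)
  have "0 < lam * L" using lam q' by linarith
  then have L: "0 < L" using lam by (simp add: zero_less_mult_iff)
  have \<Psi>_lower: "e * u - L * (snd q' + dist \<oo> (\<beta> s)) + s - u \<le> \<Psi> (s, u)" if "0 \<le> u" for s u
  proof -
    have "lam * u \<le> fst q' * (dist \<oo> (\<sigma> (lam * u)) + snd q')"
      using q_ray_dist_origin(1)[OF \<sigma>, of "lam * u"] that lam by simp
    also have "\<dots> \<le> fst q' * (dist \<oo> (\<beta> s) + dist (\<beta> s) (\<sigma> (lam * u)) + snd q')"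
      using q' dist_triangle[of \<oo> "\<sigma> (lam * u)" "\<beta> s"] by (intro mult_left_mono) auto
    finally have "lam * u / fst q' \<le> dist \<oo> (\<beta> s) + dist (\<beta> s) (\<sigma> (lam * u)) + snd q'"
      using q' by (simp add: divide_le_eq mult.commute)
    then have "L * (lam * u / fst q') \<le> L * (dist \<oo> (\<beta> s) + dist (\<beta> s) (\<sigma> (lam * u)) + snd q')"
      using L by (intro mult_left_mono) auto
    then show ?thesis by (simp add: \<Psi>_def e_def algebra_simps)
  qed
  \<comment> \<open>For \<open>s\<close> in \<open>{0..a}\<close> and \<open>u \<ge> U\<close> the
    function is nonnegative, so the negative minimum over the compact rectangle is a minimum for all
    \<open>u \<ge> 0\<close>.\<close>
  define U where "U = max b (L * (snd q' + fst q * a) / (e - 1))"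
  have U: "b \<le> U" "L * (snd q' + fst q * a) \<le> (e - 1) * U"
    using e by (auto simp: U_def max_def field_simps)
  have "continuous_on ({0..a} \<times> {0..U}) (\<lambda>x. L * dist (\<beta> (fst x)) (\<sigma> (lam * snd x)) + fst x - snd x)"
    using lam
    by (intro continuous_intros continuous_on_compose2[OF q_ray_continuous_on[OF \<beta>]]
          continuous_on_compose2[OF q_ray_continuous_on[OF \<sigma>]]) auto
  then have cont: "continuous_on ({0..a} \<times> {0..U}) \<Psi>"
    by (simp add: \<Psi>_def case_prod_unfold)
  have "{0..a} \<times> {0..U} \<noteq> {}" using \<open>0 \<le> a\<close> \<open>0 \<le> b\<close> U by auto
  then obtain x where "x \<in> {0..a} \<times> {0..U}" "\<forall>y\<in>{0..a} \<times> {0..U}. \<Psi> x \<le> \<Psi> y"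
    using continuous_attains_inf[OF _ _ cont] by (auto simp: compact_Times)
  then obtain s0 u0 where su: "s0 \<in> {0..a}" "u0 \<in> {0..U}"
    and min: "\<And>s u. s \<in> {0..a} \<Longrightarrow> u \<in> {0..U} \<Longrightarrow> \<Psi> (s0, u0) \<le> \<Psi> (s, u)"
    by (cases x) auto
  have "\<Psi> (s0, u0) \<le> \<Psi> (a, b)" using min[of a b] U \<open>0 \<le> a\<close> \<open>0 \<le> b\<close> by simp
  also have "\<dots> < - L * (r + snd q')" using ab by (simp add: \<Psi>_def)
  finally have \<Psi>0: "\<Psi> (s0, u0) < - L * (r + snd q')" .
  have min': "\<Psi> (s0, u0) \<le> \<Psi> (s, u)" if "s \<in> {0..a}" "0 \<le> u" for s u
  proof (cases "u \<le> U")
    case False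
    have "dist \<oo> (\<beta> s) \<le> fst q * s" using q_ray_dist_origin(2)[OF \<beta>] that by simp
    also have "\<dots> \<le> fst q * a" using q that by simp
    finally have "L * (snd q' + dist \<oo> (\<beta> s)) \<le> L * (snd q' + fst q * a)" using L by simp
    also have "\<dots> \<le> (e - 1) * u" using U(2) False e by (smt (verit) mult_left_mono)
    finally have "0 \<le> \<Psi> (s, u)"
      using \<Psi>_lower[OF that(2), of s] that by (simp add: algebra_simps)
    moreover have "- L * (r + snd q') \<le> 0" using L q' \<open>0 \<le> r\<close> by simp
    ultimately show ?thesis using \<Psi>0 by linarith
  qed (use min that in auto)
  show thesis
  proof
    show "first_time \<oo> \<beta> r \<le> s0"
    proof (rule ccontr)
      assume "\<not> first_time \<oo> \<beta> r \<le> s0"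
      moreover have "first_time \<oo> \<beta> r \<le> s0" if "r \<le> dist \<oo> (\<beta> s0)"
        using first_time_least(3)[OF \<beta> _ that] su by simp
      ultimately have "dist \<oo> (\<beta> s0) < r" by argo
      \<comment> \<open>Inside radius \<open>r\<close> the linear lower bound keeps
        \<open>\<Psi>\<close> from dropping below \<open>- L * (r + snd q')\<close>, contrary to
        \<open>\<Psi>0\<close>.\<close>
      then have "L * (snd q' + dist \<oo> (\<beta> s0)) \<le> L * (r + snd q')" using L by simp
      moreover have "u0 \<le> e * u0" using e su by (simp add: mult_le_cancel_right1)
      ultimately show False using \<Psi>_lower[of u0 s0] su \<Psi>0 by simp
    qed
    show "0 \<le> u0" using su by simp
    fix s u assume "0 \<le> s" "s \<le> s0" "u0 \<le> u"
    then show "L * dist (\<beta> s0) (\<sigma> (lam * u0)) + (s0 - s) + (u - u0) \<le> L * dist (\<beta> s) (\<sigma> (lam * u))"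
      using min'[of s u] su by (simp add: \<Psi>_def)
  qed
qed

text \<open>One pair of times is enough: if the slowed \<open>\<sigma>\<close> comes near
  \<open>\<beta> a\<close> so late that \<open>b - a\<close> exceeds the weighted distance and the
  constants for radius \<open>r\<close>, the minimal bridge starts beyond radius
  \<open>r\<close>.\<close>

lemma redirectable_at_close:
  fixes \<beta> \<sigma> :: "real \<Rightarrow> 'a::metric_space"
  assumes "proper_geodesic_space TYPE('a)"
    and "q_ray \<oo> q \<beta>" "q_ray \<oo> q' \<sigma>"
    and "fst q \<le> fst G" "snd q \<le> snd G" "fst q' < lam * fst G" "snd q' \<le> snd G"
    and "0 < lam" "lam \<le> 1" "0 \<le> r" "0 \<le> a" "0 \<le> b"
    and "fst G * dist (\<beta> a) (\<sigma> (lam * b)) + a - b < - fst G * (r + snd q')"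
    and "fst G \<le> fst F" "snd G \<le> snd F"
    and "redirectable \<oo> f \<sigma> \<tau>" "fst f + 1 \<le> fst F" "snd f \<le> snd F"
  shows "redirectable_at \<oo> F \<beta> \<tau> r"
proof -
  obtain s0 u0 where su: "first_time \<oo> \<beta> r \<le> s0" "0 \<le> u0"
    and opt: "\<And>s u. 0 \<le> s \<Longrightarrow> s \<le> s0 \<Longrightarrow> u0 \<le> u \<Longrightarrow>
      fst G * dist (\<beta> s0) (\<sigma> (lam * u0)) + (s0 - s) + (u - u0)
        \<le> fst G * dist (\<beta> s) (\<sigma> (lam * u))"
    by (rule minimal_bridge[OF assms(2,3,8,6,10-13)]) blast
  have "0 \<le> fst G * snd G"
    using q_ray_admissible[OF assms(2)] assms(4,5) by simp
  then have "fst G * dist (\<beta> s0) (\<sigma> (lam * u0)) + (s0 - s) + (u - u0)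
      \<le> fst G * (dist (\<beta> s) (\<sigma> (lam * u)) + snd G)" if "0 \<le> s" "s \<le> s0" "u0 \<le> u" for s u
    using opt[OF that] by (simp add: distrib_left)
  then show ?thesis
    using redirectable_at_bridge[OF assms(1-5) less_imp_le[OF assms(6)] assms(7-9) su _ assms(14-18)]
    by blast
qed


subsection \<open>Sublinear fellow travelling implies equivalence\<close>

abbreviation sublin_tracks :: "'a::metric_space \<Rightarrow> (real \<Rightarrow> 'a) \<Rightarrow> (real \<Rightarrow> 'a) \<Rightarrow> bool" where
  "sublin_tracks \<oo> \<alpha> \<beta> \<equiv>
     ((\<lambda>r. dist (point_at \<oo> \<alpha> r) (point_at \<oo> \<beta> r) / r) \<longlongrightarrow> 0) at_top"

lemma sublin_tracks_sym: "sublin_tracks \<oo> \<alpha> \<beta> \<Longrightarrow> sublin_tracks \<oo> \<beta> \<alpha>"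
  by (simp add: dist_commute)

lemma sublin_tracks_trans:
  assumes "sublin_tracks \<oo> \<alpha> \<beta>" "sublin_tracks \<oo> \<beta> \<gamma>"
  shows "sublin_tracks \<oo> \<alpha> \<gamma>"
proof (rule tendsto_sandwich[where f = "\<lambda>_. 0"])
  show "((\<lambda>r. dist (point_at \<oo> \<alpha> r) (point_at \<oo> \<beta> r) / r
      + dist (point_at \<oo> \<beta> r) (point_at \<oo> \<gamma> r) / r) \<longlongrightarrow> 0) at_top"
    using tendsto_add[OF assms] by simp
  show "\<forall>\<^sub>F r in at_top. dist (point_at \<oo> \<alpha> r) (point_at \<oo> \<gamma> r) / r
      \<le> dist (point_at \<oo> \<alpha> r) (point_at \<oo> \<beta> r) / r + dist (point_at \<oo> \<beta> r) (point_at \<oo> \<gamma> r) / r"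
    using eventually_gt_at_top[of 0]
    by eventually_elim (simp add: divide_right_mono dist_triangle flip: add_divide_distrib)
  show "\<forall>\<^sub>F r in at_top. 0 \<le> dist (point_at \<oo> \<alpha> r) (point_at \<oo> \<gamma> r) / r"
    using eventually_gt_at_top[of 0] by eventually_elim simp
qed simp

text \<open>At a large radius \<open>R\<close>, \<open>\<alpha>\<close> has spent at most about
  \<open>fst q * R\<close>, while the slowed \<open>\<beta>\<close> needs at least
  \<open>(fst q + 1/2) * R\<close>. The gap \<open>R / 2\<close> beats the sublinear distance and
  all constants. \<open>F\<close> is fixed before \<open>r\<close>, since one pair must serve all
  radii.\<close>

lemma qr_le_if_sublin_tracks:
  fixes \<alpha> \<beta> :: "real \<Rightarrow> 'a::metric_space"
  assumes space: "proper_geodesic_space TYPE('a)"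
    and \<alpha>: "q_ray \<oo> q \<alpha>" and \<beta>: "q_ray \<oo> q' \<beta>" and track: "sublin_tracks \<oo> \<alpha> \<beta>"
  shows "qr_le \<oo> \<alpha> \<beta>"
proof -
  define lam where "lam = 1 / (fst q' * (fst q + 1/2))"
  \<comment> \<open>The first summand exceeds \<open>fst q' / lam\<close>, which makes
    \<open>fst q' < lam * fst F\<close>.\<close>
  define F where "F = (fst q' * fst q' * (fst q + 1) + fst q + fst q' + 1, max (snd q) (snd q'))"
  have q: "1 \<le> fst q" "0 \<le> snd q" using q_ray_admissible[OF \<alpha>] by auto
  have q': "1 \<le> fst q'" "0 \<le> snd q'" using q_ray_admissible[OF \<beta>] by auto
  have "1 * 1 \<le> fst q' * (fst q + 1/2)" using q q' by (intro mult_mono) auto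
  then have lam: "0 < lam" "lam \<le> 1" "fst q' * lam * (fst q + 1/2) = 1"
    using q q' by (auto simp: lam_def)
  have F0: "0 \<le> fst q' * fst q' * (fst q + 1)" using q q' by simp
  have F: "fst q \<le> fst F" "snd q \<le> snd F" "snd q' \<le> snd F" "fst q' + 1 \<le> fst F" "1 \<le> fst F"
    using q q' F0 by (auto simp: F_def)
  have F': "fst q' < lam * fst F"
  proof -
    have "fst q' * (fst q' * (fst q + 1/2)) < fst F"
    proof -
      have "fst q' * (fst q' * (fst q + 1/2)) \<le> fst q' * (fst q' * (fst q + 1))"
        using q' by (intro mult_left_mono) auto
      then show ?thesis unfolding F_def fst_conv mult.assoc using q q' by linarith
    qed
    then have "lam * (fst q' * (fst q' * (fst q + 1/2))) < lam * fst F" using lam by simp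
    moreover have "lam * (fst q' * (fst q' * (fst q + 1/2))) = fst q' * (fst q' * lam * (fst q + 1/2))"
      by (simp add: algebra_simps)
    ultimately show ?thesis by (simp only: lam(3) mult_1_right)
  qed
  have "redirectable_at \<oo> F \<alpha> \<beta> r" if "0 < r" for r
  proof -
    \<comment> \<open>Half of the gap \<open>R / 2\<close> pays for the weighted distance, the other
      half for \<open>C\<close>.\<close>
    define C where "C = fst F * (r + snd q') + fst q * snd q"
    have "\<forall>\<^sub>F R in at_top. dist (point_at \<oo> \<alpha> R) (point_at \<oo> \<beta> R) / R < 1 / (4 * fst F)"
      using F by (intro order_tendstoD(2)[OF track]) simp
    then have "\<forall>\<^sub>F R in at_top. dist (point_at \<oo> \<alpha> R) (point_at \<oo> \<beta> R) / R < 1 / (4 * fst F)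
        \<and> 4 * C < R \<and> 0 < R"
      by (intro eventually_conj eventually_gt_at_top)
    then obtain R where R: "dist (point_at \<oo> \<alpha> R) (point_at \<oo> \<beta> R) / R < 1 / (4 * fst F)"
        "4 * C < R" "0 < R"
      using eventually_happens'[OF trivial_limit_at_top_linorder] by blast
    define a where "a = first_time \<oo> \<alpha> R"
    define w where "w = first_time \<oo> \<beta> R"
    have "0 \<le> a" "0 \<le> w"
      using first_time_least(1)[OF \<alpha>] first_time_least(1)[OF \<beta>] by (simp_all add: a_def w_def)
    have a: "a \<le> fst q * (R + snd q)" using first_time_bounds(1)[OF \<alpha>] R by (simp add: a_def)
    have w: "R \<le> fst q' * w" using first_time_bounds(2)[OF \<beta>] R by (simp add: w_def)
    have "(fst q + 1/2) * R \<le> (fst q + 1/2) * (fst q' * w)" using w q by (intro mult_left_mono) auto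
    also have "\<dots> = w / lam" using lam q q' by (simp add: lam_def mult.commute mult.left_commute)
    finally have wl: "(fst q + 1/2) * R \<le> w / lam" .
    have "fst F * dist (\<alpha> a) (\<beta> w) < R / 4"
      using R(1,3) F by (simp add: point_at_def a_def w_def field_simps)
    then have "fst F * dist (\<alpha> a) (\<beta> (lam * (w / lam))) + a - w / lam < - fst F * (r + snd q')"
      using lam a wl R(2) by (simp add: C_def algebra_simps)
    moreover have "0 \<le> r" "0 \<le> w / lam" using that \<open>0 \<le> w\<close> lam by simp_all
    ultimately show ?thesis
      by (intro redirectable_at_close[OF space \<alpha> \<beta> F(1,2) F' F(3) lam(1,2) _ \<open>0 \<le> a\<close> _ _
          order_refl order_refl redirectable_refl[OF \<beta>] F(4,3)])
  qed
  then show ?thesis unfolding qr_le_def redirectable_def by blast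
qed

lemma qr_class_iff:
  "\<beta> \<in> qr_class \<oo> \<alpha> \<longleftrightarrow> \<alpha> \<in> qg_rays \<oo> \<and> \<beta> \<in> qg_rays \<oo> \<and> qr_le \<oo> \<alpha> \<beta> \<and> qr_le \<oo> \<beta> \<alpha>"
  by (auto simp: qr_class_def qr_rel_def)

lemma sublin_class_iff:
  "\<beta> \<in> sublin_class \<oo> \<alpha> \<longleftrightarrow> \<beta> \<in> qg_rays \<oo> \<and> sublin_tracks \<oo> \<alpha> \<beta>"
  by (auto simp: sublin_class_def)

lemma qr_le_in_sublin_class:
  fixes \<alpha> :: "real \<Rightarrow> 'a::metric_space"
  assumes "proper_geodesic_space TYPE('a)" "\<beta> \<in> sublin_class \<oo> \<alpha>" "\<gamma> \<in> sublin_class \<oo> \<alpha>"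
  shows "qr_le \<oo> \<beta> \<gamma>"
  using assms qr_le_if_sublin_tracks sublin_tracks_trans[of \<oo> \<beta> \<alpha> \<gamma>] sublin_tracks_sym[of \<oo> \<alpha> \<beta>]
  unfolding sublin_class_iff qg_rays_def by blast


subsection \<open>Morse geodesics\<close>

text \<open>A difference of norms bounds the distance, and along \<open>g\<close> it equals the
  distance. So the point of \<open>g\<close> with the norm of \<open>x\<close> is nearest up to a
  factor 2.\<close>

lemma infdist_geodesic_ray:
  assumes g: "q_ray \<oo> (1, 0) g"
  shows "dist x (g (dist \<oo> x)) \<le> 2 * infdist x (g ` {0..})"
proof -
  have half: "dist x (g (dist \<oo> x)) / 2 \<le> dist x (g w)" if "0 \<le> w" for w
  proof -
    have "dist \<oo> (g w) = w" using dist_geodesic_ray[OF g, of 0 w] g that by (simp add: q_ray_def)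
    then have "\<bar>dist \<oo> x - w\<bar> \<le> dist x (g w)"
      using abs_dist_diff_le[of x \<oo> "g w"] by (simp add: dist_commute)
    moreover have "dist (g w) (g (dist \<oo> x)) = \<bar>dist \<oo> x - w\<bar>"
      using dist_geodesic_ray[OF g that] by simp
    ultimately show ?thesis
      using dist_triangle[of x "g (dist \<oo> x)" "g w"] by simp
  qed
  have ne: "g ` {0..} \<noteq> {}" by simp
  have "dist x (g (dist \<oo> x)) / 2 \<le> infdist x (g ` {0..})"
    unfolding infdist_notempty[OF ne] by (rule cINF_greatest[OF ne]) (use half in auto)
  then show ?thesis by simp
qed

lemma segment_gaugeD:
  assumes "segment_gauge \<oo> \<kappa> \<alpha> m" "u \<le> v" "quasi_geodesic_on q {u..v} \<beta>"
    and "\<beta> u \<in> \<alpha> ` {0..}" "\<beta> v \<in> \<alpha> ` {0..}"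
  shows "\<beta> ` {u..v} \<subseteq> kappa_nbhd \<oo> \<kappa> \<alpha> (m q)"
  using assms unfolding segment_gauge_def by blast

text \<open>Followed until it has reached radius \<open>r\<close> and merged with
  \<open>\<alpha>\<close>, the redirected ray is a segment with both endpoints on
  \<open>\<alpha>\<close>, so the gauge confines it. The bound involves the constants
  \<open>p\<close> of the redirection, not those of \<open>\<beta>\<close>.\<close>

lemma infdist_point_at_le:
  assumes \<beta>: "q_ray \<oo> q \<beta>" and red: "redirectable_at \<oo> p \<beta> \<alpha> r" and "0 \<le> r"
    and gauge: "segment_gauge \<oo> \<kappa> \<alpha> m" and "\<alpha> 0 = \<oo>"
  shows "infdist (point_at \<oo> \<beta> r) (\<alpha> ` {0..}) \<le> m p * \<kappa> r"
proof -
  obtain \<gamma> where \<gamma>: "q_ray \<oo> p \<gamma>" "agree_up_to \<oo> \<gamma> \<beta> r" "eventually_coincides \<gamma> \<alpha>"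
    using red by (auto simp: redirectable_at_def)
  obtain u v where uv: "u > 0" "\<And>t. t \<ge> u \<Longrightarrow> 0 \<le> t + v \<and> \<gamma> t = \<alpha> (t + v)"
    using \<gamma>(3) unfolding eventually_coincides_def by blast
  define t where "t = first_time \<oo> \<beta> r"
  define V where "V = max u t"
  have t: "0 \<le> t" using first_time_least(1)[OF \<beta>] by (simp add: t_def)
  have "quasi_geodesic_on p {0..V} \<gamma>"
    using \<gamma>(1) quasi_geodesic_on_mono[of p "{0..}" \<gamma> p "{0..V}"] by (auto simp: q_ray_def)
  moreover have "\<gamma> 0 \<in> \<alpha> ` {0..}" "\<gamma> V \<in> \<alpha> ` {0..}"
    using \<gamma>(1) assms(5) uv(2)[of V] by (auto simp: V_def q_ray_def intro: rev_image_eqI)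
  ultimately have "\<gamma> ` {0..V} \<subseteq> kappa_nbhd \<oo> \<kappa> \<alpha> (m p)"
    using segment_gaugeD[OF gauge, of 0 V p \<gamma>] t by (simp add: V_def)
  moreover have "\<gamma> t = point_at \<oo> \<beta> r"
    using \<gamma>(2) t by (simp add: agree_up_to_def point_at_def t_def)
  ultimately show ?thesis
    using t dist_point_at[OF \<beta> \<open>0 \<le> r\<close>] by (force simp: V_def kappa_nbhd_def)
qed

lemma point_at_geodesic_ray:
  "q_ray \<oo> (1, 0) g \<Longrightarrow> 0 \<le> r \<Longrightarrow> point_at \<oo> g r = g r"
  by (simp add: point_at_def first_time_geodesic_ray)

text \<open>One \<open>p\<close> serves every radius, so the two rays are at most
  \<open>2 * m p * \<kappa> r\<close> apart at radius \<open>r\<close>.\<close>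

lemma sublin_tracks_geodesic:
  assumes sub: "sublinear \<kappa>" and g: "q_ray \<oo> (1, 0) g"
    and gauge: "segment_gauge \<oo> \<kappa> g m" and \<beta>: "q_ray \<oo> q \<beta>" and le: "qr_le \<oo> \<beta> g"
  shows "sublin_tracks \<oo> \<beta> g"
proof -
  obtain p where p: "redirectable \<oo> p \<beta> g" using le by (auto simp: qr_le_def)
  show ?thesis
  proof (rule tendsto_sandwich[where f = "\<lambda>_. 0"])
    have "((\<lambda>r. \<kappa> r / r) \<longlongrightarrow> 0) at_top" using sub by (simp add: sublinear_def)
    from tendsto_mult_left[OF this, of "2 * m p"]
    show "((\<lambda>r. 2 * m p * (\<kappa> r / r)) \<longlongrightarrow> 0) at_top" by simp
    show "\<forall>\<^sub>F r in at_top. dist (point_at \<oo> \<beta> r) (point_at \<oo> g r) / r \<le> 2 * m p * (\<kappa> r / r)"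
      using eventually_gt_at_top[of 0]
    proof eventually_elim
      case (elim r)
      have "infdist (point_at \<oo> \<beta> r) (g ` {0..}) \<le> m p * \<kappa> r"
        using infdist_point_at_le[OF \<beta> _ _ gauge] p elim g by (auto simp: redirectable_def q_ray_def)
      then have "dist (point_at \<oo> \<beta> r) (g r) \<le> 2 * (m p * \<kappa> r)"
        using infdist_geodesic_ray[OF g, of "point_at \<oo> \<beta> r"] dist_point_at[OF \<beta>, of r] elim by simp
      then show ?case
        using elim point_at_geodesic_ray[OF g, of r] by (simp add: divide_simps)
    qed
    show "\<forall>\<^sub>F r in at_top. 0 \<le> dist (point_at \<oo> \<beta> r) (point_at \<oo> g r) / r"
      using eventually_gt_at_top[of 0] by eventually_elim simp
  qed simp
qed

text \<open>The Morse geodesic \<open>g\<close> mediates: a ray that redirects to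
  \<open>\<alpha>\<close> redirects to \<open>g\<close> by transitivity, hence tracks
  \<open>g\<close> and with it \<open>\<alpha>\<close>.\<close>

lemma sublin_class_eq_qr_class:
  fixes \<alpha> :: "real \<Rightarrow> 'a::metric_space"
  assumes space: "proper_geodesic_space TYPE('a)" and sub: "sublinear \<kappa>"
    and \<alpha>: "\<alpha> \<in> qg_rays \<oo>" and g: "g \<in> sublin_class \<oo> \<alpha>" "q_ray \<oo> (1, 0) g"
    and gauge: "segment_gauge \<oo> \<kappa> g m"
  shows "sublin_class \<oo> \<alpha> = qr_class \<oo> \<alpha>"
proof (intro set_eqI iffI)
  have self: "\<alpha> \<in> sublin_class \<oo> \<alpha>" using \<alpha> by (simp add: sublin_class_iff)
  fix \<beta>
  show "\<beta> \<in> qr_class \<oo> \<alpha>" if "\<beta> \<in> sublin_class \<oo> \<alpha>"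
    using that \<alpha> qr_le_in_sublin_class[OF space self that]
      qr_le_in_sublin_class[OF space that self]
    by (simp add: qr_class_iff sublin_class_iff)
  show "\<beta> \<in> sublin_class \<oo> \<alpha>" if "\<beta> \<in> qr_class \<oo> \<alpha>"
  proof -
    have \<beta>: "\<beta> \<in> qg_rays \<oo>" "qr_le \<oo> \<beta> \<alpha>" using that by (auto simp: qr_class_iff)
    have "qr_le \<oo> \<beta> g"
      using qr_le_trans[OF \<beta>(2) qr_le_in_sublin_class[OF space self g(1)] \<beta>(1) \<alpha>] .
    then have "sublin_tracks \<oo> \<beta> g"
      using sublin_tracks_geodesic[OF sub g(2) gauge] \<beta>(1) by (auto simp: qg_rays_def)
    then show ?thesis
      using \<beta>(1) g(1) sublin_tracks_trans[of \<oo> \<alpha> g \<beta>] sublin_tracks_sym[of \<oo> \<beta> g]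
      by (simp add: sublin_class_iff)
  qed
qed


subsection \<open>Comparison of the neighbourhoods\<close>

text \<open>The constant segment at the base point has its endpoints on \<open>\<alpha>\<close>, and
  a distance is nonnegative.\<close>

lemma segment_gauge_nonneg:
  assumes gauge: "segment_gauge \<oo> \<kappa> \<alpha> m" and "\<alpha> 0 = \<oo>" and sub: "sublinear \<kappa>" and "admissible q"
  shows "0 \<le> m q"
proof -
  have "(\<lambda>_. \<oo>) ` {0..0::real} \<subseteq> kappa_nbhd \<oo> \<kappa> \<alpha> (m q)"
    using assms(2,4)
    by (intro segment_gaugeD[OF gauge]) (auto simp: quasi_geodesic_on_def admissible_def)
  then have "infdist \<oo> (\<alpha> ` {0..}) \<le> m q * \<kappa> 0" by (simp add: kappa_nbhd_def)
  then have "0 \<le> m q * \<kappa> 0" using infdist_nonneg[of \<oo> "\<alpha> ` {0..}"] by linarith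
  moreover have "0 < \<kappa> 0" using sub unfolding sublinear_def by (metis less_le_trans order_refl zero_less_one)
  ultimately show ?thesis by (simp add: zero_le_mult_iff)
qed

text \<open>Properness makes the preimage of \<open>{0..C}\<close> compact, hence bounded; by
  nonnegativity it contains every admissible \<open>q\<close> with
  \<open>m q \<le> C\<close>.\<close>

lemma segment_gauge_sublevel_bounded:
  assumes gauge: "segment_gauge \<oo> \<kappa> \<alpha> m" and "\<alpha> 0 = \<oo>" and "sublinear \<kappa>"
  obtains A where "1 \<le> A" "\<And>q. admissible q \<Longrightarrow> m q \<le> C \<Longrightarrow> fst q \<le> A \<and> snd q \<le> A"
proof -
  have "proper_map euclidean euclidean m" using gauge by (simp add: segment_gauge_def)
  then have "compactin euclidean {q. q \<in> topspace euclidean \<and> m q \<in> {0..C}}"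
    by (rule compactin_proper_map_preimage) simp
  then have "bounded {q. m q \<in> {0..C}}" by (auto dest: compact_imp_bounded)
  then obtain B where B: "\<And>q. m q \<in> {0..C} \<Longrightarrow> norm q \<le> B"
    unfolding bounded_iff by blast
  have "fst q \<le> max 1 B \<and> snd q \<le> max 1 B" if "admissible q" "m q \<le> C" for q
  proof -
    have "norm q \<le> B" using B segment_gauge_nonneg[OF assms that(1)] that(2) by simp
    moreover have "fst q \<le> norm q" "snd q \<le> norm q"
      using norm_fst_le[of "fst q" "snd q"] norm_snd_le[of "snd q" "fst q"] by auto
    ultimately show ?thesis by linarith
  qed
  then show thesis using that[of "max 1 B"] by simp
qed

lemma sublinear_cmult:
  assumes "sublinear \<kappa>" "1 \<le> c"
  shows "sublinear (\<lambda>t. c * \<kappa> t)"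
proof -
  have "1 \<le> c * \<kappa> t" if "0 \<le> t" for t
    using assms that mult_mono[of 1 c 1 "\<kappa> t"] by (simp add: sublinear_def)
  moreover have "((\<lambda>t. c * \<kappa> t / t) \<longlongrightarrow> 0) at_top"
    using tendsto_mult_left[of "\<lambda>t. \<kappa> t / t" 0 at_top c] assms by (simp add: sublinear_def)
  ultimately show ?thesis
    using assms by (auto simp: sublinear_def intro!: continuous_intros concave_on_cmul)
qed

text \<open>Nothing relates the constants \<open>E q\<close> for different \<open>q\<close>. However, a \<open>q\<close>-ray with \<open>q\<close> in a
  bounded set is also an \<open>(A, A)\<close>-ray for one fixed \<open>A\<close>, so that only \<open>E (A, A)\<close> matters.\<close>

lemma initial_part_if_redirectable:
  assumes sub: "sublinear \<kappa>" and g: "q_ray \<oo> (1, 0) g" and gauge: "morse_gauge \<oo> \<kappa> g m"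
    and \<alpha>\<^sub>0: "\<alpha>\<^sub>0 \<in> qg_rays \<oo>" "qr_le \<oo> \<alpha>\<^sub>0 g" and "0 < r"
  obtains R where "0 < R" "\<And>q \<beta>. q_ray \<oo> q \<beta> \<Longrightarrow> m q \<le> r / (2 * \<kappa> r) \<Longrightarrow>
    (\<And>q. q_ray \<oo> q \<beta> \<Longrightarrow> redirectable_at \<oo> (E q) \<beta> \<alpha>\<^sub>0 R) \<Longrightarrow>
    initial_part \<oo> \<beta> r \<subseteq> kappa_nbhd \<oo> \<kappa> g (m q)"
proof -
  have seg: "segment_gauge \<oo> \<kappa> g m" using gauge by (simp add: morse_gauge_def)
  have g0: "g 0 = \<oo>" using g by (simp add: q_ray_def)
  obtain A where A: "1 \<le> A"
      "\<And>q. admissible q \<Longrightarrow> m q \<le> r / (2 * \<kappa> r) \<Longrightarrow> fst q \<le> A \<and> snd q \<le> A"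
    by (rule segment_gauge_sublevel_bounded[OF seg g0 sub]) blast
  obtain f where f: "redirectable \<oo> f \<alpha>\<^sub>0 g" using \<alpha>\<^sub>0 by (auto simp: qr_le_def)
  obtain q\<^sub>0 where q\<^sub>0: "q_ray \<oo> q\<^sub>0 \<alpha>\<^sub>0" using \<alpha>\<^sub>0 by (auto simp: qg_rays_def)
  \<comment> \<open>Constants for going from \<open>\<beta>\<close> by way of
    \<open>\<alpha>\<^sub>0\<close> to \<open>g\<close>. They do not involve \<open>q\<close>, so
    one sublinear function, a multiple of \<open>\<kappa>\<close>, and one radius serve all
    rays.\<close>
  define p where "p = (max (fst (E (A, A))) (fst f + 1), max (snd (E (A, A))) (snd f))"
  have "sublinear (\<lambda>t. max 1 (m p) * \<kappa> t)" by (rule sublinear_cmult[OF sub]) simp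
  then obtain R where R: "0 < R" "\<And>q \<beta>. q_ray \<oo> q \<beta> \<Longrightarrow> m q \<le> r / (2 * \<kappa> r) \<Longrightarrow>
      infdist (point_at \<oo> \<beta> R) (g ` {0..}) \<le> max 1 (m p) * \<kappa> R \<Longrightarrow>
      initial_part \<oo> \<beta> r \<subseteq> kappa_nbhd \<oo> \<kappa> g (m q)"
    using gauge \<open>0 < r\<close> unfolding morse_gauge_def by meson
  show thesis
  proof (rule that[OF R(1)])
    fix q \<beta>
    assume \<beta>: "q_ray \<oo> q \<beta>" "m q \<le> r / (2 * \<kappa> r)"
      and red: "\<And>q. q_ray \<oo> q \<beta> \<Longrightarrow> redirectable_at \<oo> (E q) \<beta> \<alpha>\<^sub>0 R"
    have "admissible q" using q_ray_admissible[OF \<beta>(1)] by (simp add: admissible_def)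
    then have "q_ray \<oo> (A, A) \<beta>" using A(2)[OF _ \<beta>(2)] by (intro q_ray_mono[OF \<beta>(1)]) auto
    then have "redirectable_at \<oo> p \<beta> g R"
      unfolding p_def by (intro redirectable_at_trans[OF red q\<^sub>0 \<beta>(1) f])
    then have "infdist (point_at \<oo> \<beta> R) (g ` {0..}) \<le> m p * \<kappa> R"
      using infdist_point_at_le[OF \<beta>(1) _ _ seg g0] R(1) by simp
    also have "\<dots> \<le> max 1 (m p) * \<kappa> R"
    proof (rule mult_right_mono)
      have "1 \<le> \<kappa> R" using sub R(1) by (simp add: sublinear_def)
      then show "0 \<le> \<kappa> R" by simp
    qed simp
    finally show "initial_part \<oo> \<beta> r \<subseteq> kappa_nbhd \<oo> \<kappa> g (m q)" by (rule R(2)[OF \<beta>])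
  qed
qed

text \<open>If \<open>q\<close> is large compared to \<open>r\<close>, the constants are so generous that \<open>\<beta>\<close> may go back to the
  base point after reaching radius \<open>r\<close>.\<close>

lemma redirectable_at_large_constants:
  fixes \<beta> g :: "real \<Rightarrow> 'a::metric_space"
  assumes space: "proper_geodesic_space TYPE('a)" and g: "q_ray \<oo> (1, 0) g"
    and \<beta>: "q_ray \<oo> q \<beta>" and "0 < r"
    and large: "(3 * fst q + 2) * r \<le> fst q * fst q + fst q + snd q"
    and F: "fst q + 1 \<le> fst F" "fst q + snd q \<le> snd F"
    and red: "redirectable \<oo> f g \<tau>" and fF: "fst f + 1 \<le> fst F" "snd f \<le> snd F"
  shows "redirectable_at \<oo> F \<beta> \<tau> r"
proof -
  \<comment> \<open>The bridge joins \<open>\<beta> t\<close> to the base point, so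
    \<open>s0 = t\<close> and \<open>u0 = 0\<close>; with \<open>G\<close> below,
    \<open>lam * fst G = 1\<close>, the least value allowed for a geodesic.\<close>
  define lam where "lam = 1 / (fst q + 1)"
  define t where "t = first_time \<oo> \<beta> r"
  define G where "G = (fst q + 1, fst q + snd q)"
  have q: "1 \<le> fst q" "0 \<le> snd q" using q_ray_admissible[OF \<beta>] by auto
  have lam: "0 < lam" "lam \<le> 1" "lam * (fst q + 1) = 1" using q by (auto simp: lam_def)
  have g0: "g 0 = \<oo>" using g by (simp add: q_ray_def)
  have t: "dist \<oo> (\<beta> t) = r" using dist_point_at[OF \<beta>] \<open>0 < r\<close> by (simp add: point_at_def t_def)
  have "t \<le> fst q * (r + snd q)"
    using first_time_bounds(1)[OF \<beta>] \<open>0 < r\<close> by (simp add: t_def)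
  \<comment> \<open>By the bound on \<open>t\<close> this is \<open>large\<close> once
    \<open>fst q * snd q\<close> cancels; the right-hand side is
    \<open>fst G * snd G\<close>.\<close>
  then have num: "2 * ((fst q + 1) * r) + t \<le> (fst q + 1) * (fst q + snd q)"
    using large by (simp add: algebra_simps)
  have "fst G * dist (\<beta> t) (g (lam * 0)) + (t - s) + (u - 0)
      \<le> fst G * (dist (\<beta> s) (g (lam * u)) + snd G)" if su: "0 \<le> s" "s \<le> t" "0 \<le> u" for s u
  proof -
    have "dist \<oo> (\<beta> s) \<le> r"
    proof (cases "s = t")
      case False
      then show ?thesis using first_time_least(3)[OF \<beta> su(1), of r] su by (force simp: t_def)
    qed (use t in simp)
    moreover have "dist \<oo> (g (lam * u)) = lam * u"
      using dist_geodesic_ray[OF g, of 0 "lam * u"] g0 lam su by simp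
    ultimately have "lam * u \<le> r + dist (\<beta> s) (g (lam * u))"
      using dist_triangle[of \<oo> "g (lam * u)" "\<beta> s"] by simp
    then have "(fst q + 1) * (lam * u) \<le> (fst q + 1) * (r + dist (\<beta> s) (g (lam * u)))"
      using q by (intro mult_left_mono) auto
    moreover have "(fst q + 1) * (lam * u) = u"
      using lam(3) by (simp add: mult.commute flip: mult.assoc)
    moreover have "dist (\<beta> t) (g (lam * 0)) = r" using t g0 by (simp add: dist_commute)
    ultimately show ?thesis using num su by (simp add: G_def algebra_simps)
  qed
  then show ?thesis
    using q F lam
    by (intro redirectable_at_bridge[OF space \<beta> g _ _ _ _ lam(1,2) _ _ _ _ _ red fF,
          where G = G and ?s0.0 = t and ?u0.0 = 0])
      (auto simp: G_def t_def)
qed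

text \<open>Splitting into large and bounded constants allows \<open>R\<close> to be chosen before
  \<open>q\<close>. Rays with bounded constants are \<open>(A, B)\<close>-rays, hence uniformly
  close to \<open>g\<close> at radius \<open>R\<close>, and the minimal bridge applies; the others
  return to the base point.\<close>

lemma redirectable_if_initial_part:
  fixes g :: "real \<Rightarrow> 'a::metric_space"
  assumes space: "proper_geodesic_space TYPE('a)" and sub: "sublinear \<kappa>"
    and g: "q_ray \<oo> (1, 0) g" and gauge: "segment_gauge \<oo> \<kappa> g m" and "0 < r"
  obtains R where "0 < R" "\<And>q \<beta> f F. q_ray \<oo> q \<beta> \<Longrightarrow>
    (\<And>q. q_ray \<oo> q \<beta> \<Longrightarrow> m q \<le> R / (2 * \<kappa> R) \<Longrightarrow> initial_part \<oo> \<beta> R \<subseteq> kappa_nbhd \<oo> \<kappa> g (m q)) \<Longrightarrow>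
    redirectable \<oo> f g \<tau> \<Longrightarrow> fst f + 1 \<le> fst F \<Longrightarrow> snd f \<le> snd F \<Longrightarrow>
    fst q + 1 \<le> fst F \<Longrightarrow> fst q + snd q \<le> snd F \<Longrightarrow> redirectable_at \<oo> F \<beta> \<tau> r"
proof -
  \<comment> \<open>If \<open>fst q > A\<close>, its square dominates \<open>3 * fst q * r\<close>;
    otherwise \<open>snd q > B\<close> dominates \<open>(3 * fst q + 2) * r\<close>. Either way the
    return to the base point is affordable.\<close>
  define A where "A = 3 * r + 1"
  define B where "B = (3 * A + 2) * r"
  define M where "M = m (A, B)"
  have A: "1 \<le> A" "0 \<le> B" using \<open>0 < r\<close> by (auto simp: A_def B_def)
  have "g 0 = \<oo>" using g by (simp add: q_ray_def)
  then have M: "0 \<le> M"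
    unfolding M_def using A by (intro segment_gauge_nonneg[OF gauge _ sub]) (auto simp: admissible_def)
  have "((\<lambda>t. \<kappa> t / t) \<longlongrightarrow> 0) at_top" using sub by (simp add: sublinear_def)
  from tendsto_mult_left[OF this, of "(A + 1) * 2 * M"]
  have "\<forall>\<^sub>F R in at_top. (A + 1) * 2 * M * (\<kappa> R / R) < 1 / 4"
    by (intro order_tendstoD(2)) auto
  then have "\<forall>\<^sub>F R in at_top. (A + 1) * 2 * M * (\<kappa> R / R) < 1 / 4
      \<and> 4 * (A * B + (A + 1) * r) < R \<and> 0 < R"
    by (intro eventually_conj eventually_gt_at_top)
  then obtain R where R: "(A + 1) * 2 * M * (\<kappa> R / R) < 1 / 4"
      "4 * (A * B + (A + 1) * r) < R" "0 < R"
    using eventually_happens'[OF trivial_limit_at_top_linorder] by blast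
  have \<kappa>R: "1 \<le> \<kappa> R" using sub R by (simp add: sublinear_def)
  have R1: "(A + 1) * (2 * (M * \<kappa> R)) < R / 4" using R(1,3) by (simp add: field_simps)
  moreover have "1 * (2 * (M * \<kappa> R)) \<le> (A + 1) * (2 * (M * \<kappa> R))"
    using A M \<kappa>R by (intro mult_right_mono) auto
  ultimately have "2 * (M * \<kappa> R) \<le> R" using R(3) by simp
  \<comment> \<open>The neighbourhood condition speaks only of constants of small gauge; this makes
    \<open>(A, B)\<close> one of them.\<close>
  then have MR: "M \<le> R / (2 * \<kappa> R)" using \<kappa>R by (simp add: field_simps)
  show thesis
  proof (rule that[OF R(3)])
    fix q \<beta> f F
    assume \<beta>: "q_ray \<oo> q \<beta>"
      and near: "\<And>q. q_ray \<oo> q \<beta> \<Longrightarrow> m q \<le> R / (2 * \<kappa> R) \<Longrightarrow>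
        initial_part \<oo> \<beta> R \<subseteq> kappa_nbhd \<oo> \<kappa> g (m q)"
      and red: "redirectable \<oo> f g \<tau>" and fF: "fst f + 1 \<le> fst F" "snd f \<le> snd F"
      and F: "fst q + 1 \<le> fst F" "fst q + snd q \<le> snd F"
    have q: "1 \<le> fst q" "0 \<le> snd q" using q_ray_admissible[OF \<beta>] by auto
    show "redirectable_at \<oo> F \<beta> \<tau> r"
    proof (cases "fst q \<le> A \<and> snd q \<le> B")
      case False
      have "(3 * fst q + 2) * r \<le> fst q * fst q + fst q + snd q"
      proof (cases "fst q \<le> A")
        case True
        then have "(3 * fst q + 2) * r \<le> B" unfolding B_def using \<open>0 < r\<close> by (intro mult_right_mono) auto
        also have "B \<le> snd q" using False True by simp
        finally show ?thesis using q by (simp add: add_increasing)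
      next
        case False
        then have "A * fst q \<le> fst q * fst q" "6 * r \<le> 2 * fst q"
          using q by (auto simp: A_def)
        then show ?thesis using q \<open>0 < r\<close> by (simp add: A_def algebra_simps)
      qed
      then show ?thesis
        using redirectable_at_large_constants[OF space g \<beta> \<open>0 < r\<close> _ F red fF] by simp
    next
      case True
      \<comment> \<open>The value \<open>fst q + 1/2\<close> exceeds \<open>fst q\<close>, which
        delays \<open>g\<close> by about \<open>R / 2\<close> against \<open>\<beta>\<close>, and
        stays below \<open>fst q + 1\<close>, which gives
        \<open>1 < lam * (fst q + 1)\<close>.\<close>
      define lam where "lam = 1 / (fst q + 1/2)"
      define a where "a = first_time \<oo> \<beta> R"
      have lam: "0 < lam" "lam \<le> 1" "R / lam = R * (fst q + 1/2)" using q by (auto simp: lam_def)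
      have "q_ray \<oo> (A, B) \<beta>" using True by (intro q_ray_mono[OF \<beta>]) auto
      then have "initial_part \<oo> \<beta> R \<subseteq> kappa_nbhd \<oo> \<kappa> g M"
        using near[of "(A, B)"] MR by (simp add: M_def)
      moreover have a: "0 \<le> a" "a \<le> fst q * (R + snd q)"
        using first_time_least(1)[OF \<beta>] first_time_bounds(1)[OF \<beta>] R by (auto simp: a_def)
      then have "\<beta> a \<in> initial_part \<oo> \<beta> R" by (simp add: initial_part_def a_def)
      moreover have \<beta>a: "dist \<oo> (\<beta> a) = R"
        using dist_point_at[OF \<beta>, of R] R by (simp add: point_at_def a_def)
      ultimately have "infdist (\<beta> a) (g ` {0..}) \<le> M * \<kappa> R" by (auto simp: kappa_nbhd_def)
      then have "dist (\<beta> a) (g R) \<le> 2 * (M * \<kappa> R)"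
        using infdist_geodesic_ray[OF g, of "\<beta> a"] \<beta>a by simp
      then have "(fst q + 1) * dist (\<beta> a) (g R) \<le> (A + 1) * (2 * (M * \<kappa> R))"
        using True q by (intro mult_mono) auto
      moreover have "fst q * snd q \<le> A * B" "(fst q + 1) * r \<le> (A + 1) * r"
        using True q A \<open>0 < r\<close> by (auto intro: mult_mono)
      ultimately have "(fst q + 1) * dist (\<beta> a) (g R) + a - R * (fst q + 1/2) < - (fst q + 1) * r"
        using a(2) R1 R(2) by (simp add: algebra_simps)
      then show ?thesis
        using q F fF R lam a \<open>0 < r\<close>
        by (intro redirectable_at_close[OF space \<beta> g _ _ _ _ lam(1,2) _ a(1) _ _ _ _ red fF,
              where G = "(fst q + 1, snd q)" and b = "R / lam"])
          (auto simp: lam_def)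
    qed
  qed
qed

section \<open>Sped-up geodesics and the size of the redirecting constants\<close>

lemma speed_up_geodesic:
  assumes g: "q_ray \<oo> (1, 0) g" and "admissible q"
  shows "q_ray \<oo> q (\<lambda>t. g (fst q * t))" "sublin_tracks \<oo> g (\<lambda>t. g (fst q * t))"
proof -
  have q: "1 \<le> fst q" "0 \<le> snd q" using assms(2) by (auto simp: admissible_def)
  have d: "dist (g (fst q * s)) (g (fst q * t)) = fst q * (t - s)" if "0 \<le> s" "s \<le> t" for s t
    using dist_geodesic_ray[OF g, of "fst q * s" "fst q * t"] q that
    by (simp add: mult_left_mono flip: right_diff_distrib)
  have "t - s \<le> fst q * (fst q * (t - s) + snd q)" if "0 \<le> s" "s \<le> t" for s t
  proof -
    have "1 * 1 \<le> fst q * fst q" using q by (intro mult_mono) auto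
    then have "1 * (t - s) \<le> fst q * fst q * (t - s)" using that by (intro mult_right_mono) auto
    moreover have "0 \<le> fst q * snd q" using q by simp
    ultimately show ?thesis by (simp add: distrib_left mult.assoc)
  qed
  then have "quasi_geodesic_on q {0..} (\<lambda>t. g (fst q * t))"
    using assms(2) by (intro quasi_geodesic_onI) (auto simp: d)
  then show ray: "q_ray \<oo> q (\<lambda>t. g (fst q * t))" using g by (simp add: q_ray_def)
  have pt: "point_at \<oo> (\<lambda>t. g (fst q * t)) r = g r" if "0 \<le> r" for r
    using dist_point_at[OF ray that] first_time_least(1)[OF ray, of r] d[of 0] g
    by (simp add: point_at_def q_ray_def)
  have "\<forall>\<^sub>F r in at_top. 0 = dist (point_at \<oo> g r) (point_at \<oo> (\<lambda>t. g (fst q * t)) r) / r"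
    using eventually_ge_at_top[of 0] by eventually_elim (simp add: point_at_geodesic_ray[OF g] pt)
  then show "sublin_tracks \<oo> g (\<lambda>t. g (fst q * t))"
    by (rule Lim_transform_eventually[rotated]) simp
qed

text \<open>The redirecting ray copies the sped-up geodesic up to radius 1, that is for a positive
  time, so its Lipschitz constant is at least \<open>fst q\<close>.\<close>

lemma redirectable_speed_up_geodesic:
  assumes g: "q_ray \<oo> (1, 0) g" and q: "admissible q"
    and red: "redirectable \<oo> f (\<lambda>t. g (fst q * t)) \<tau>"
  shows "fst q \<le> fst f"
proof -
  let ?\<alpha> = "\<lambda>t. g (fst q * t)"
  define t where "t = first_time \<oo> ?\<alpha> 1"
  note \<alpha> = speed_up_geodesic(1)[OF g q]
  obtain \<gamma> where \<gamma>: "q_ray \<oo> f \<gamma>" "agree_up_to \<oo> \<gamma> ?\<alpha> 1"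
    using red unfolding redirectable_def redirectable_at_def by (meson zero_less_one)
  have t: "0 \<le> t" "dist \<oo> (?\<alpha> t) = 1"
    using first_time_least(1)[OF \<alpha>, of 1] dist_point_at[OF \<alpha>, of 1]
    by (simp_all add: t_def point_at_def)
  have "dist \<oo> (?\<alpha> t) = fst q * t"
    using dist_geodesic_ray[OF g, of 0 "fst q * t"] g q t by (simp add: q_ray_def admissible_def)
  moreover have "\<gamma> t = ?\<alpha> t" using \<gamma>(2) t by (simp add: agree_up_to_def t_def)
  ultimately have "fst q * t \<le> fst f * t" "0 < t"
    using q_ray_dist_origin(2)[OF \<gamma>(1) t(1)] t by (auto intro: le_neq_trans)
  then show ?thesis by simp
qed

section \<open>The two boundaries as sets and as topological spaces\<close>

theorem theorem3:
  fixes \<oo> :: "'a::metric_space"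
    and c :: "(real \<Rightarrow> 'a) set \<Rightarrow> real \<Rightarrow> 'a"
    and f :: "(real \<Rightarrow> 'a) set \<Rightarrow> real \<times> real \<Rightarrow> real \<times> real"
    and \<kappa> :: "real \<Rightarrow> real"
    and g :: "(real \<Rightarrow> 'a) set \<Rightarrow> real \<Rightarrow> 'a"
    and m :: "(real \<Rightarrow> 'a) set \<Rightarrow> real \<times> real \<Rightarrow> real"
  assumes "assumption0 \<oo>" and "assumption1 \<oo> c" and "assumption2 \<oo> c f"
    and "sublinear \<kappa>"
    and "kappa_central \<oo> \<kappa> g m"
  shows "(\<forall>\<alpha>. kappa_morse \<oo> \<kappa> \<alpha> \<longrightarrow> sublin_class \<oo> \<alpha> = qr_class \<oo> \<alpha>) \<and>
    kappa_boundary \<oo> \<kappa> \<subseteq> qr_classes \<oo> \<and>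
    (\<forall>a\<in>kappa_boundary \<oo> \<kappa>. \<forall>A. A \<subseteq> kappa_boundary \<oo> \<kappa> \<longrightarrow>
       (is_nbhd (kappa_boundary_nbhd \<oo> \<kappa> g m) a A \<longleftrightarrow>
        (\<exists>M \<subseteq> bordification \<oo>. is_nbhd (bordification_nbhd \<oo> c f) (Inr a) M \<and>
            A = kappa_boundary \<oo> \<kappa> \<inter> Inr -` M))) \<and>
    (\<forall>T. has_nbhds T (bordification \<oo>) (bordification_nbhd \<oo> c f) \<longrightarrow>
       (\<forall>T\<^sub>\<kappa>. has_nbhds T\<^sub>\<kappa> (kappa_boundary \<oo> \<kappa>) (kappa_boundary_nbhd \<oo> \<kappa> g m) \<longleftrightarrow>
              T\<^sub>\<kappa> = subtopology (boundary_topology \<oo> T) (kappa_boundary \<oo> \<kappa>)))"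
proof -
  have space: "proper_geodesic_space TYPE('a)"
    using assms(1) by (simp add: assumption0_def)
  have eq: "sublin_class \<oo> \<alpha> = qr_class \<oo> \<alpha>" if "kappa_morse \<oo> \<kappa> \<alpha>" for \<alpha>
  proof (rule sublin_class_eq_qr_class[OF space assms(4)])
    have "sublin_class \<oo> \<alpha> \<in> kappa_boundary \<oo> \<kappa>" using that by (auto simp: kappa_boundary_def)
    then show "g (sublin_class \<oo> \<alpha>) \<in> sublin_class \<oo> \<alpha>" "q_ray \<oo> (1, 0) (g (sublin_class \<oo> \<alpha>))"
        "segment_gauge \<oo> \<kappa> (g (sublin_class \<oo> \<alpha>)) (m (sublin_class \<oo> \<alpha>))"
      using assms(5) by (auto simp: kappa_central_def morse_gauge_def)
    show "\<alpha> \<in> qg_rays \<oo>" using that by (simp add: kappa_morse_def)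
  qed
  have subset: "kappa_boundary \<oo> \<kappa> \<subseteq> qr_classes \<oo>"
  proof
    fix a assume "a \<in> kappa_boundary \<oo> \<kappa>"
    then obtain \<alpha> where "kappa_morse \<oo> \<kappa> \<alpha>" "a = sublin_class \<oo> \<alpha>"
      by (auto simp: kappa_boundary_def)
    then show "a \<in> qr_classes \<oo>"
      using eq by (auto simp: qr_classes_def qr_class_def kappa_morse_def intro: quotientI)
  qed
  have compare: "(\<forall>r>0. \<exists>R>0. \<forall>b\<in>kappa_boundary \<oo> \<kappa>.
        Inr b \<in> redirect_nbhd \<oo> c f a R \<longrightarrow> b \<in> kappa_boundary_nbhd \<oo> \<kappa> g m a r) \<and>
      (\<forall>r>0. \<exists>R>0. \<forall>b\<in>kappa_boundary \<oo> \<kappa>.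
        b \<in> kappa_boundary_nbhd \<oo> \<kappa> g m a R \<longrightarrow> Inr b \<in> redirect_nbhd \<oo> c f a r)"
    if a: "a \<in> kappa_boundary \<oo> \<kappa>" for a
  proof -
    have ga: "g a \<in> a" "q_ray \<oo> (1, 0) (g a)" "morse_gauge \<oo> \<kappa> (g a) (m a)"
      using assms(5) a by (auto simp: kappa_central_def)
    then have seg: "segment_gauge \<oo> \<kappa> (g a) (m a)" by (simp add: morse_gauge_def)
    have aP: "a \<in> qr_classes \<oo>" using a subset by blast
    have ca: "c a \<in> a" using assms(2) aP by (auto simp: assumption1_def)
    obtain \<alpha> where \<alpha>: "a = sublin_class \<oo> \<alpha>" using a by (auto simp: kappa_boundary_def)
    have le: "qr_le \<oo> \<beta> \<gamma>" if "\<beta> \<in> a" "\<gamma> \<in> a" for \<beta> \<gamma>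
      using qr_le_in_sublin_class[OF space] that \<alpha> by blast
    have red: "redirectable \<oo> (f a q) \<beta> (c a)" if "\<beta> \<in> a" "q_ray \<oo> q \<beta>" for q \<beta>
      using assms(3) aP that le[OF ga(1) ga(1)] ga(1)
      unfolding assumption2_def qr_class_le_def by blast
    \<comment> \<open>The sped-up geodesic is a \<open>q\<close>-ray in \<open>a\<close>, so
      \<open>f a q\<close> must redirect it.\<close>
    have speed: "fst q \<le> fst (f a q)" if q: "admissible q" for q
    proof (rule redirectable_speed_up_geodesic[OF ga(2) q], rule red)
      show ray: "q_ray \<oo> q (\<lambda>t. g a (fst q * t))" by (rule speed_up_geodesic(1)[OF ga(2) q])
      have "sublin_tracks \<oo> \<alpha> (\<lambda>t. g a (fst q * t))"
        using speed_up_geodesic(2)[OF ga(2) q] ga(1) \<alpha> sublin_tracks_trans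
        by (auto simp: sublin_class_iff)
      moreover have "(\<lambda>t. g a (fst q * t)) \<in> qg_rays \<oo>"
        using ray unfolding qg_rays_def by blast
      ultimately show "(\<lambda>t. g a (fst q * t)) \<in> a" by (subst \<alpha>) (simp add: sublin_class_iff)
    qed
    \<comment> \<open>A geodesic ray is a \<open>q\<close>-ray for every admissible
      \<open>q\<close>, so \<open>f a q\<close> also serves for \<open>g a\<close> itself.\<close>
    have gred: "redirectable \<oo> (f a q) (g a) (c a)" if "admissible q" for q
      using that by (intro red ga(1) q_ray_mono[OF ga(2)]) (auto simp: admissible_def)
    have "\<exists>R>0. \<forall>b\<in>kappa_boundary \<oo> \<kappa>.
        Inr b \<in> redirect_nbhd \<oo> c f a R \<longrightarrow> b \<in> kappa_boundary_nbhd \<oo> \<kappa> g m a r" if r: "0 < r" for r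
    proof -
      have "c a \<in> qg_rays \<oo>" using ca \<alpha> by (simp add: sublin_class_iff)
      then obtain R where R: "0 < R" "\<And>q \<beta>. q_ray \<oo> q \<beta> \<Longrightarrow> m a q \<le> r / (2 * \<kappa> r) \<Longrightarrow>
          (\<And>q. q_ray \<oo> q \<beta> \<Longrightarrow> redirectable_at \<oo> (enlarge f a q) \<beta> (c a) R) \<Longrightarrow>
          initial_part \<oo> \<beta> r \<subseteq> kappa_nbhd \<oo> \<kappa> (g a) (m a q)"
        using initial_part_if_redirectable[OF assms(4) ga(2,3) _ le[OF ca ga(1)] r,
            where E = "enlarge f a"] by blast
      have "b \<in> kappa_boundary_nbhd \<oo> \<kappa> g m a r"
        if b: "b \<in> kappa_boundary \<oo> \<kappa>" "Inr b \<in> redirect_nbhd \<oo> c f a R" for b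
      proof -
        have "redirectable_at \<oo> (enlarge f a q) \<beta> (c a) R" if "\<beta> \<in> b" "q_ray \<oo> q \<beta>" for q \<beta>
          using b(2) that unfolding redirect_nbhd_def mem_Collect_eq rays_of.simps by blast
        then show ?thesis
          unfolding kappa_boundary_nbhd_def using b(1) R(2) by blast
      qed
      then show ?thesis using R(1) by blast
    qed
    moreover have "\<exists>R>0. \<forall>b\<in>kappa_boundary \<oo> \<kappa>.
        b \<in> kappa_boundary_nbhd \<oo> \<kappa> g m a R \<longrightarrow> Inr b \<in> redirect_nbhd \<oo> c f a r" if r: "0 < r" for r
    proof -
      obtain R where R: "0 < R" "\<And>q \<beta> f F. q_ray \<oo> q \<beta> \<Longrightarrow>
          (\<And>q. q_ray \<oo> q \<beta> \<Longrightarrow> m a q \<le> R / (2 * \<kappa> R) \<Longrightarrow>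
            initial_part \<oo> \<beta> R \<subseteq> kappa_nbhd \<oo> \<kappa> (g a) (m a q)) \<Longrightarrow>
          redirectable \<oo> f (g a) (c a) \<Longrightarrow> fst f + 1 \<le> fst F \<Longrightarrow> snd f \<le> snd F \<Longrightarrow>
          fst q + 1 \<le> fst F \<Longrightarrow> fst q + snd q \<le> snd F \<Longrightarrow> redirectable_at \<oo> F \<beta> (c a) r"
        by (rule redirectable_if_initial_part[OF space assms(4) ga(2) seg r]) blast
      have "redirectable_at \<oo> (enlarge f a q) \<beta> (c a) r"
        if b: "b \<in> kappa_boundary_nbhd \<oo> \<kappa> g m a R" "\<beta> \<in> b" "q_ray \<oo> q \<beta>" for b q \<beta>
      proof -
        have q: "admissible q" using q_ray_admissible[OF b(3)] by (simp add: admissible_def)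
        have "\<And>q. q_ray \<oo> q \<beta> \<Longrightarrow> m a q \<le> R / (2 * \<kappa> R) \<Longrightarrow>
            initial_part \<oo> \<beta> R \<subseteq> kappa_nbhd \<oo> \<kappa> (g a) (m a q)"
          using b by (auto simp: kappa_boundary_nbhd_def)
        \<comment> \<open>For \<open>F = enlarge f a q\<close>, \<open>speed\<close> gives
          \<open>fst q + 1 \<le> fst F\<close>; the other three inequalities are read off from
          \<open>enlarge\<close>.\<close>
        then show ?thesis
          using speed[OF q] by (intro R(2)[OF b(3) _ gred[OF q]]) (auto simp: enlarge_def)
      qed
      then show ?thesis
        using R(1) subset
        by (intro exI[of _ R]) (auto simp: redirect_nbhd_def bordification_def)
    qed
    ultimately show ?thesis by blast
  qed
  \<comment> \<open>This compares neighbourhood systems without presupposing that they come from a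
    topology.\<close>
  have nbhds: "is_nbhd (kappa_boundary_nbhd \<oo> \<kappa> g m) a A \<longleftrightarrow>
      (\<exists>M \<subseteq> bordification \<oo>. is_nbhd (bordification_nbhd \<oo> c f) (Inr a) M \<and>
        A = kappa_boundary \<oo> \<kappa> \<inter> Inr -` M)"
    if a: "a \<in> kappa_boundary \<oo> \<kappa>" and A: "A \<subseteq> kappa_boundary \<oo> \<kappa>" for a A
  proof
    assume "is_nbhd (kappa_boundary_nbhd \<oo> \<kappa> g m) a A"
    then obtain r where r: "0 < r" "kappa_boundary_nbhd \<oo> \<kappa> g m a r \<subseteq> A"
      by (auto simp: is_nbhd_def)
    obtain R where R: "0 < R" "\<forall>b\<in>kappa_boundary \<oo> \<kappa>.
        Inr b \<in> redirect_nbhd \<oo> c f a R \<longrightarrow> b \<in> kappa_boundary_nbhd \<oo> \<kappa> g m a r"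
      using compare[OF a] r(1) by blast
    show "\<exists>M \<subseteq> bordification \<oo>. is_nbhd (bordification_nbhd \<oo> c f) (Inr a) M \<and>
        A = kappa_boundary \<oo> \<kappa> \<inter> Inr -` M"
    proof (intro exI conjI)
      \<comment> \<open>Adding the copy of \<open>A\<close> makes the trace exactly
        \<open>A\<close>, as the redirecting neighbourhood alone has its trace inside
        \<open>A\<close>.\<close>
      show "redirect_nbhd \<oo> c f a R \<union> Inr ` A \<subseteq> bordification \<oo>"
        using A subset by (auto simp: redirect_nbhd_def bordification_def)
      show "is_nbhd (bordification_nbhd \<oo> c f) (Inr a) (redirect_nbhd \<oo> c f a R \<union> Inr ` A)"
        using R(1) by (auto simp: is_nbhd_def)
      show "A = kappa_boundary \<oo> \<kappa> \<inter> Inr -` (redirect_nbhd \<oo> c f a R \<union> Inr ` A)"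
        using A R(2) r(2) by blast
    qed
  next
    assume "\<exists>M \<subseteq> bordification \<oo>. is_nbhd (bordification_nbhd \<oo> c f) (Inr a) M \<and>
        A = kappa_boundary \<oo> \<kappa> \<inter> Inr -` M"
    then obtain M r where M: "0 < r" "redirect_nbhd \<oo> c f a r \<subseteq> M"
        "A = kappa_boundary \<oo> \<kappa> \<inter> Inr -` M"
      by (auto simp: is_nbhd_def)
    obtain R where "0 < R" "\<forall>b\<in>kappa_boundary \<oo> \<kappa>.
        b \<in> kappa_boundary_nbhd \<oo> \<kappa> g m a R \<longrightarrow> Inr b \<in> redirect_nbhd \<oo> c f a r"
      using compare[OF a] M(1) by blast
    moreover have "kappa_boundary_nbhd \<oo> \<kappa> g m a R \<subseteq> kappa_boundary \<oo> \<kappa>"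
      by (auto simp: kappa_boundary_nbhd_def)
    ultimately show "is_nbhd (kappa_boundary_nbhd \<oo> \<kappa> g m) a A"
      using M(2,3) unfolding is_nbhd_def by blast
  qed
  have sub: "has_nbhds (subtopology (boundary_topology \<oo> T) (kappa_boundary \<oo> \<kappa>))
      (kappa_boundary \<oo> \<kappa>) (kappa_boundary_nbhd \<oo> \<kappa> g m)"
    if T: "has_nbhds T (bordification \<oo>) (bordification_nbhd \<oo> c f)" for T
  proof -
    let ?S = "subtopology (boundary_topology \<oo> T) (kappa_boundary \<oo> \<kappa>)"
    have top: "topspace T = bordification \<oo>" using T by (simp add: has_nbhds_def)
    have T': "(\<exists>U. openin T U \<and> Inr a \<in> U \<and> U \<subseteq> M) \<longleftrightarrow> is_nbhd (bordification_nbhd \<oo> c f) (Inr a) M"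
      if "a \<in> kappa_boundary \<oo> \<kappa>" "M \<subseteq> bordification \<oo>" for a M
      using T that subset unfolding has_nbhds_def bordification_def by blast
    \<comment> \<open>Restricting first to all classes and then to the \<kappa>-boundary amounts to
      taking the trace at once.\<close>
    have S: "openin ?S U \<longleftrightarrow> (\<exists>V. openin T V \<and> U = kappa_boundary \<oo> \<kappa> \<inter> Inr -` V)" for U
      unfolding openin_subtopology boundary_topology_def openin_pullback_topology
      using subset by blast
    have "topspace ?S = kappa_boundary \<oo> \<kappa>"
      using subset top
      by (auto simp: boundary_topology_def topspace_pullback_topology bordification_def)
    moreover have "(\<exists>U. openin ?S U \<and> a \<in> U \<and> U \<subseteq> A) \<longleftrightarrow> is_nbhd (kappa_boundary_nbhd \<oo> \<kappa> g m) a A"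
      if a: "a \<in> kappa_boundary \<oo> \<kappa>" and A: "A \<subseteq> kappa_boundary \<oo> \<kappa>" for a A
    proof
      assume "\<exists>U. openin ?S U \<and> a \<in> U \<and> U \<subseteq> A"
      then obtain V where V: "openin T V" "Inr a \<in> V" "kappa_boundary \<oo> \<kappa> \<inter> Inr -` V \<subseteq> A"
        unfolding S by blast
      have Vsub: "V \<subseteq> bordification \<oo>" using openin_subset[OF V(1)] top by simp
      then have "is_nbhd (bordification_nbhd \<oo> c f) (Inr a) V" using T'[OF a] V by blast
      then have "is_nbhd (kappa_boundary_nbhd \<oo> \<kappa> g m) a (kappa_boundary \<oo> \<kappa> \<inter> Inr -` V)"
        using nbhds[OF a] Vsub by blast
      then show "is_nbhd (kappa_boundary_nbhd \<oo> \<kappa> g m) a A"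
        using V(3) unfolding is_nbhd_def by blast
    next
      assume "is_nbhd (kappa_boundary_nbhd \<oo> \<kappa> g m) a A"
      then obtain M where M: "M \<subseteq> bordification \<oo>" "is_nbhd (bordification_nbhd \<oo> c f) (Inr a) M"
          "A = kappa_boundary \<oo> \<kappa> \<inter> Inr -` M"
        using nbhds[OF a A] by blast
      then obtain V where "openin T V" "Inr a \<in> V" "V \<subseteq> M" using T'[OF a] by blast
      then show "\<exists>U. openin ?S U \<and> a \<in> U \<and> U \<subseteq> A"
        unfolding S using a M(3) by (intro exI[of _ "kappa_boundary \<oo> \<kappa> \<inter> Inr -` V"]) auto
    qed
    ultimately show ?thesis by (simp add: has_nbhds_def)
  qed
  \<comment> \<open>Neighbourhoods determine a topology, so the subspace topology is the only one
    with these.\<close>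
  have induced: "has_nbhds T' (kappa_boundary \<oo> \<kappa>) (kappa_boundary_nbhd \<oo> \<kappa> g m) \<longleftrightarrow>
      T' = subtopology (boundary_topology \<oo> T) (kappa_boundary \<oo> \<kappa>)"
    if T: "has_nbhds T (bordification \<oo>) (bordification_nbhd \<oo> c f)" for T T'
    by (metis has_nbhds_unique sub[OF T])
  show ?thesis
    by (intro conjI ballI allI impI) (assumption | rule eq subset nbhds induced)+
qed

end
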